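(* Let $\Gamma$ be a subgroup of finite index of $\mathrm{SL}_2(\mathbb Z)$, let $\mathfrak a$ be a cusp and let $\tau\ge2$. Let $A^{\mathfrak a}_\tau$ be the set of real $x$ for which there exists $C>0$ such that $|x-p/q|\le Cq^{-\tau}$ holds for infinitely many rationals $p/q$ (in lowest terms, $q>0$) lying in the $\Gamma$-orbit of $\mathfrak a$. Then $A^{\mathfrak a}_\tau$ has Hausdorff dimension $2/\tau$, and $\mathcal H^{2/\tau}(A^{\mathfrak a}_\tau)=\infty$, where $\mathcal H^t$ denotes the $t$-dimensional outer Hausdorff measure.
   Context: Cusps are elements of $\mathbb Q\cup\{\infty\}$, on which $\mathrm{SL}_2(\mathbb Z)$ acts by Möbius transformations $z\mapsto(az+b)/(cz+d)$; two cusps are equivalent ($p/q\sim\mathfrak a$) if $p/q=\gamma(\mathfrak a)$ for some $\gamma\in\Gamma$. *)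

theory Defs
  imports "HOL-Analysis.Analysis" "HOL-Algebra.Coset"
begin

definition SL2Z :: "(int^2^2) set" where
  "SL2Z = {M. det M = 1}"

definition SL2Z_group :: "(int^2^2) monoid" where
  "SL2Z_group = \<lparr>carrier = SL2Z, mult = (\<lambda>M N. M ** N), one = mat 1\<rparr>"

datatype cusp = Fin rat | Infty

definition cusp_act :: "int^2^2 \<Rightarrow> cusp \<Rightarrow> cusp" where
  "cusp_act M z = (let a = of_int (M$1$1); b = of_int (M$1$2);
                       c = of_int (M$2$1); d = of_int (M$2$2) in
     (case z of
        Fin r \<Rightarrow> (if c * r + d = 0 then Infty else Fin ((a * r + b) / (c * r + d)))
      | Infty \<Rightarrow> (if c = 0 then Infty else Fin (a / c))))"

definition cusp_orbit :: "(int^2^2) set \<Rightarrow> cusp \<Rightarrow> cusp set" where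
  "cusp_orbit \<Gamma> \<aa> = (\<lambda>g. cusp_act g \<aa>) ` \<Gamma>"

definition approx_set :: "(int^2^2) set \<Rightarrow> cusp \<Rightarrow> real \<Rightarrow> real set" where
  "approx_set \<Gamma> \<aa> \<tau> = {x. \<exists>C>0. infinite {pq :: int \<times> int. let p = fst pq; q = snd pq in
      q > 0 \<and> coprime p q \<and> Fin (Fract p q) \<in> cusp_orbit \<Gamma> \<aa> \<and>
      \<bar>x - real_of_int p / real_of_int q\<bar> \<le> C * real_of_int q powr (- \<tau>)}}"

text \<open>diam(U)^s with the conventions diam(empty)^s = 0 and 0^0 = 1.\<close>
definition diam_pow :: "real \<Rightarrow> real set \<Rightarrow> real" where
  "diam_pow s U = (if U = {} then 0 else if s = 0 then 1 else diameter U powr s)"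

definition hausdorff_pre :: "real \<Rightarrow> real \<Rightarrow> real set \<Rightarrow> ennreal" where
  "hausdorff_pre s \<delta> A =
     (INF U \<in> {U :: nat \<Rightarrow> real set. A \<subseteq> (\<Union>i. U i) \<and>
                 (\<forall>i. bounded (U i) \<and> diameter (U i) \<le> \<delta>)}.
        (\<Sum>i. ennreal (diam_pow s (U i))))"

definition hausdorff_measure :: "real \<Rightarrow> real set \<Rightarrow> ennreal" where
  "hausdorff_measure s A = (SUP \<delta> \<in> {0<..}. hausdorff_pre s \<delta> A)"

definition hausdorff_dim :: "real set \<Rightarrow> real" where
  "hausdorff_dim A = Inf {s. s \<ge> 0 \<and> hausdorff_measure s A = 0}"

end

theory Submission
  imports Defs
begin

text \<open>
  Upper bound: the intervals of radius \<open>C q\<^sup>-\<^sup>\<tau>\<close> around all fractions cover, and their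
  \<open>s\<close>-th powers are summable for \<open>s > 2/\<tau>\<close>.

  Lower bound: since \<open>\<Gamma>\<close> has finite index, there are finitely many vectors \<open>(u, v)\<close> with positive
  entries such that every \<open>M\<close> in the modular group maps one of the fractions \<open>u/v\<close> into the orbit.
  Applied to the matrix of two Farey neighbours this puts an orbit point of comparable denominator
  between any two neighbours of order \<open>N\<close>, so every interval contains a positive proportion of
  \<open>N\<^sup>2\<close> well separated orbit points.

  For \<open>\<tau> > 2\<close> put \<open>s = 2/\<tau> < 1\<close>. Spreading mass over the cells next to these orbit points on many
  consecutive scales shows that such cells have dyadic net content at least \<open>c |I|\<^sup>s\<close> in
  every dyadic cell \<open>I\<close>. As \<open>s < 1\<close>, passing to the two halves of \<open>I\<close> improves \<open>c\<close> by the factor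
  \<open>2\<^sup>1\<^sup>-\<^sup>s\<close> until \<open>c = 1\<close>. With \<open>c = 1\<close> every cell of a finite family can be replaced by a
  finite family of deeper good cells without any loss of content, and compactness carries the
  content over to the limsup set. For \<open>\<tau> = 2\<close> the set contains every irrational number.
\<close>

section \<open>Orbits of cusps under subgroups of finite index\<close>

text \<open>One scale is not enough. In a cell \<open>I\<close> there are about
  \<open>|I| * \<alpha> ^ (- k)\<close> separated orbit points of the order belonging to generation
  \<open>k\<close>, each with mass \<open>\<alpha> ^ k\<close>, where
  \<open>\<alpha> = 2 powr (- s)\<close> turns generations into s-th powers of lengths. Their total
  is about \<open>|I|\<close>, short of \<open>|I| ^ s\<close>; this dictates about
  \<open>|I| ^ (s - 1)\<close> scales. The constant has to be exactly 1 because the limsup set needs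
  infinitely many generations of replacement, and a constant \<open>c < 1\<close> would decay like
  \<open>c ^ n\<close>. Infinite rather than merely positive measure comes from starting with
  \<open>M\<close> unit cells, whose content is \<open>M\<close>, for every \<open>M\<close>. For
  \<tau> = 2 this route is closed, since then \<open>2 * \<alpha> = 1\<close> and halving gains
  nothing. Bounded factors lost in denominators and distances are harmless, because the constant
  \<open>C\<close> in the approximation set is free.\<close>

definition cusp_of :: "int \<Rightarrow> int \<Rightarrow> cusp" where
  "cusp_of x y = (if y = 0 then Infty else Fin (Fract x y))"

lemma cusp_act_cusp_of:
  assumes "x \<noteq> 0 \<or> y \<noteq> 0"
  shows "cusp_act M (cusp_of x y) = cusp_of (M$1$1 * x + M$1$2 * y) (M$2$1 * x + M$2$2 * y)"
proof (cases "y = 0")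
  case True
  then show ?thesis using assms
    by (auto simp: cusp_act_def cusp_of_def Let_def Fract_of_int_quotient)
next
  case False
  have "(of_int (M$2$1) * (of_int x / of_int y) + of_int (M$2$2) = (0::rat)) \<longleftrightarrow>
        (of_int (M$2$1 * x + M$2$2 * y) = (0::rat))"
    using False by (simp add: field_simps)
  also have "\<dots> \<longleftrightarrow> M$2$1 * x + M$2$2 * y = 0"
    by (simp only: of_int_eq_0_iff)
  finally have eq: "(of_int (M$2$1) * (of_int x / of_int y) + of_int (M$2$2) = (0::rat)) \<longleftrightarrow>
        M$2$1 * x + M$2$2 * y = 0" .
  show ?thesis
  proof (cases "M$2$1 * x + M$2$2 * y = 0")
    case True
    then show ?thesis
      using eq False by (simp add: cusp_act_def cusp_of_def Let_def Fract_of_int_quotient)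
  next
    case nz: False
    have lin: "of_int a * (of_int x / of_int y) + of_int b = (of_int (a * x + b * y) / of_int y :: rat)"
      for a b using False by (simp add: add_divide_distrib)
    have "(of_int (M$1$1) * (of_int x / of_int y) + of_int (M$1$2)) /
          (of_int (M$2$1) * (of_int x / of_int y) + of_int (M$2$2)) =
          (of_int (M$1$1 * x + M$1$2 * y) / of_int (M$2$1 * x + M$2$2 * y) :: rat)"
      unfolding lin using False by simp
    then show ?thesis
      using eq nz False by (simp add: cusp_act_def cusp_of_def Let_def Fract_of_int_quotient)
  qed
qed

lemma ex_cusp_of: "\<exists>x y. coprime x y \<and> (y > 0 \<or> y = 0 \<and> x = 1) \<and> \<aa> = cusp_of x y"
proof (cases \<aa>)
  case (Fin r)
  obtain x y where "r = Fract x y" "y > 0" "coprime x y"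
    by (cases r)
  then show ?thesis using Fin
    by (intro exI[of _ x] exI[of _ y]) (simp add: cusp_of_def)
next
  case Infty
  then show ?thesis
    by (intro exI[of _ 1] exI[of _ 0]) (simp add: cusp_of_def)
qed

lemma coprime_det_one_image:
  fixes a b c d x y :: int
  assumes det: "a * d - b * c = 1" and cop: "coprime x y"
  shows "coprime (a * x + b * y) (c * x + d * y)"
proof (rule coprimeI)
  fix g assume g: "g dvd a * x + b * y" "g dvd c * x + d * y"
  have "g dvd d * (a * x + b * y) - b * (c * x + d * y)"
    using g by (intro dvd_diff dvd_mult)
  also have "d * (a * x + b * y) - b * (c * x + d * y) = (a * d - b * c) * x"
    by (simp add: algebra_simps)
  finally have 1: "g dvd x" using det by simp
  have "g dvd a * (c * x + d * y) - c * (a * x + b * y)"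
    using g by (intro dvd_diff dvd_mult)
  also have "a * (c * x + d * y) - c * (a * x + b * y) = (a * d - b * c) * y"
    by (simp add: algebra_simps)
  finally have 2: "g dvd y" using det by simp
  show "is_unit g" using cop 1 2 by (rule coprime_common_divisor)
qed

definition mat22 :: "int \<Rightarrow> int \<Rightarrow> int \<Rightarrow> int \<Rightarrow> int^2^2" where
  "mat22 a b c d = vector [vector [a, b], vector [c, d]]"

lemma mat22_nth [simp]:
  "mat22 a b c d $ 1 $ 1 = a" "mat22 a b c d $ 1 $ 2 = b"
  "mat22 a b c d $ 2 $ 1 = c" "mat22 a b c d $ 2 $ 2 = d"
  by (simp_all add: mat22_def)

lemma mat22_eqI: "M $ 1 $ 1 = a \<Longrightarrow> M $ 1 $ 2 = b \<Longrightarrow> M $ 2 $ 1 = c \<Longrightarrow> M $ 2 $ 2 = d \<Longrightarrow> M = mat22 a b c d"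
  by (simp add: vec_eq_iff forall_2)

lemma mat22_in_SL2Z: "mat22 a b c d \<in> SL2Z \<longleftrightarrow> a * d - b * c = 1"
  by (simp add: SL2Z_def det_2)

lemma matrix_mult_22: "(M ** N) $ i $ j = M $ i $ 1 * N $ 1 $ j + M $ i $ 2 * N $ 2 $ j"
  for M N :: "int^2^2"
  by (simp add: matrix_matrix_mult_def sum_2)

text \<open>If \<open>a\<close> represents the right coset of \<open>M\<close>, then
  \<open>M = h ** a\<close> with \<open>h\<close> in \<Gamma>, so \<open>M\<close> times the inverse
  of \<open>a\<close> lies in \<Gamma>. Thus \<open>R\<close> collects inverses of coset
  representatives; for determinant 1 the inverse is the adjugate \<open>adj\<close>.\<close>

lemma finite_coset_reps:
  assumes "subgroup \<Gamma> SL2Z_group" "finite (rcosets\<^bsub>SL2Z_group\<^esub> \<Gamma>)"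
  obtains R where "finite R" "R \<subseteq> SL2Z" "\<And>M. M \<in> SL2Z \<Longrightarrow> \<exists>g\<in>R. M ** g \<in> \<Gamma>"
proof -
  let ?G = SL2Z_group
  define adj :: "int^2^2 \<Rightarrow> int^2^2" where
    "adj M = mat22 (M$2$2) (- M$1$2) (- M$2$1) (M$1$1)" for M
  have one: "mat 1 \<in> \<Gamma>"
    using subgroup.one_closed[OF assms(1)] by (simp add: SL2Z_group_def)
  have "\<exists>a. a \<in> SL2Z \<and> X = \<Gamma> #>\<^bsub>?G\<^esub> a" if "X \<in> rcosets\<^bsub>?G\<^esub> \<Gamma>" for X
    using that by (auto simp: RCOSETS_def SL2Z_group_def)
  then obtain rep where rep: "rep X \<in> SL2Z" "X = \<Gamma> #>\<^bsub>?G\<^esub> rep X"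
    if "X \<in> rcosets\<^bsub>?G\<^esub> \<Gamma>" for X by metis
  show thesis
  proof
    show "finite ((\<lambda>X. adj (rep X)) ` (rcosets\<^bsub>?G\<^esub> \<Gamma>))" using assms(2) by simp
    have adj: "adj M \<in> SL2Z" if "M \<in> SL2Z" for M
      using that by (simp add: adj_def mat22_in_SL2Z) (simp add: SL2Z_def det_2 mult.commute)
    then show "(\<lambda>X. adj (rep X)) ` (rcosets\<^bsub>?G\<^esub> \<Gamma>) \<subseteq> SL2Z" using rep by blast
    fix M assume M: "M \<in> SL2Z"
    let ?X = "\<Gamma> #>\<^bsub>?G\<^esub> M"
    have X: "?X \<in> rcosets\<^bsub>?G\<^esub> \<Gamma>" using M by (auto simp: RCOSETS_def SL2Z_group_def)
    have "M \<in> ?X"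
      using one by (auto simp: r_coset_def SL2Z_group_def intro!: bexI[of _ "mat 1"])
    then have "M \<in> \<Gamma> #>\<^bsub>?G\<^esub> rep ?X" using rep(2)[OF X] by simp
    then obtain h where h: "h \<in> \<Gamma>" "M = h ** rep ?X"
      by (auto simp: r_coset_def SL2Z_group_def)
    have "rep ?X ** adj (rep ?X) = mat 1"
      using rep(1)[OF X]
      by (simp add: vec_eq_iff forall_2 matrix_mult_22 adj_def mat_def SL2Z_def det_2 mult.commute)
    then have "h ** rep ?X ** adj (rep ?X) = h"
      by (simp add: matrix_mul_assoc[symmetric])
    then have "M ** adj (rep ?X) = h"
      using h(2) by metis
    then show "\<exists>g\<in>(\<lambda>X. adj (rep X)) ` (rcosets\<^bsub>?G\<^esub> \<Gamma>). M ** g \<in> \<Gamma>"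
      using X h(1) by auto
  qed
qed

text \<open>If \<open>M ** B ** g\<close> lies in \<Gamma>, it sends \<aa> to \<open>M\<close>
  applied to the image of \<aa> under \<open>B ** g\<close>, and that image takes finitely many
  values. When the columns of \<open>M\<close> are neighbouring fractions, positive \<open>u\<close>
  and \<open>v\<close> make the result a weighted mediant, hence a point between them.\<close>

lemma orbit_vectors:
  assumes "subgroup \<Gamma> SL2Z_group" "finite (rcosets\<^bsub>SL2Z_group\<^esub> \<Gamma>)"
  obtains K :: int where "K \<ge> 1"
    "\<And>a b c d. a * d - b * c = 1 \<Longrightarrow>
       \<exists>u v. 1 \<le> u \<and> u \<le> K \<and> 1 \<le> v \<and> v \<le> K \<and> coprime u v
         \<and> cusp_of (a * u + b * v) (c * u + d * v) \<in> cusp_orbit \<Gamma> \<aa>"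
proof -
  obtain R where R: "finite R" "R \<subseteq> SL2Z" "\<And>M. M \<in> SL2Z \<Longrightarrow> \<exists>g\<in>R. M ** g \<in> \<Gamma>"
    using finite_coset_reps[OF assms] by blast
  have "\<exists>x y. coprime x y \<and> (y > 0 \<or> y = 0 \<and> x = 1) \<and> cusp_act g \<aa> = cusp_of x y" for g
    by (rule ex_cusp_of)
  then obtain X Y where XY: "coprime (X g) (Y g)" "Y g > 0 \<or> Y g = 0 \<and> X g = 1"
    "cusp_act g \<aa> = cusp_of (X g) (Y g)" for g by metis
  obtain x0 y0 where xy0: "coprime x0 y0" "\<aa> = cusp_of x0 y0" using ex_cusp_of by metis
  \<comment> \<open>\<open>k\<close> exceeds every \<open>\<bar>X g\<bar>\<close>, so
    \<open>X g + k * Y g\<close> is positive once \<open>Y g \<ge> 1\<close>; for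
    \<open>Y g = 0\<close> it is positive by the normalisation \<open>X g = 1\<close>.\<close>
  define k where "k = 1 + (\<Sum>g\<in>R. \<bar>X g\<bar>)"
  have k: "\<bar>X g\<bar> < k" if "g \<in> R" for g
    using member_le_sum[of g R "\<lambda>g. \<bar>X g\<bar>"] that R(1) by (simp add: k_def)
  \<comment> \<open>the matrix \<open>(1 k; 1 k + 1)\<close> makes all representatives positive\<close>
  define U where "U g = X g + k * Y g" for g
  define V where "V g = X g + (k + 1) * Y g" for g
  have UV: "1 \<le> U g" "1 \<le> V g" if "g \<in> R" for g
  proof -
    have "1 \<le> X g + k * Y g"
    proof (cases "Y g = 0")
      case False
      then have "Y g \<ge> 1" using XY(2)[of g] by auto
      then have "k * 1 \<le> k * Y g" using k[OF that] by (intro mult_left_mono) auto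
      then show ?thesis using k[OF that] by auto
    qed (use XY(2)[of g] in auto)
    moreover have "Y g \<ge> 0" using XY(2)[of g] by auto
    ultimately show "1 \<le> U g" "1 \<le> V g" by (auto simp: U_def V_def algebra_simps)
  qed
  have UV0: "0 \<le> U g + V g" if "g \<in> R" for g
    using UV[OF that] by simp
  define K where "K = 1 + (\<Sum>g\<in>R. U g + V g)"
  have K: "U g \<le> K \<and> V g \<le> K" if "g \<in> R" for g
  proof -
    have "U g + V g \<le> (\<Sum>g\<in>R. U g + V g)"
      using that R(1) UV0 by (intro member_le_sum) auto
    then show ?thesis using UV[OF that] by (auto simp: K_def)
  qed
  show thesis
  proof
    show "K \<ge> 1" unfolding K_def using sum_nonneg[OF UV0] by simp
    fix a b c d :: int assume det: "a * d - b * c = 1"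
    define B where "B = mat22 1 k 1 (k + 1)"
    have "mat22 a b c d ** B = mat22 (a + b) (a * k + b * (k + 1)) (c + d) (c * k + d * (k + 1))"
      by (intro mat22_eqI) (simp_all add: matrix_mult_22 B_def)
    moreover have "(a + b) * (c * k + d * (k + 1)) - (a * k + b * (k + 1)) * (c + d) = a * d - b * c"
      by (simp add: algebra_simps)
    ultimately have "mat22 a b c d ** B \<in> SL2Z" using det by (simp add: mat22_in_SL2Z)
    then obtain g where g: "g \<in> R" "mat22 a b c d ** B ** g \<in> \<Gamma>" using R(3) by blast
    define N where "N = mat22 a b c d ** B ** g"
    \<comment> \<open>The composition is checked on integer vectors, where both sides are matrix
      products; coprimality keeps the vectors non-zero, as \<open>cusp_act_cusp_of\<close>
      requires.\<close>
    have "cusp_act N \<aa> = cusp_act (mat22 a b c d ** B) (cusp_act g \<aa>)"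
    proof -
      let ?x = "g$1$1 * x0 + g$1$2 * y0" and ?y = "g$2$1 * x0 + g$2$2 * y0"
      have nz: "x0 \<noteq> 0 \<or> y0 \<noteq> 0" using xy0(1) by auto
      have "g \<in> SL2Z" using g R by auto
      then have "coprime ?x ?y"
        using coprime_det_one_image[OF _ xy0(1)] by (simp add: SL2Z_def det_2)
      then have nz2: "?x \<noteq> 0 \<or> ?y \<noteq> 0" by auto
      show ?thesis unfolding xy0(2) cusp_act_cusp_of[OF nz] cusp_act_cusp_of[OF nz2]
        by (simp add: N_def matrix_mult_22 algebra_simps)
    qed
    also have "\<dots> = cusp_of (a * U g + b * V g) (c * U g + d * V g)"
    proof -
      have nz: "X g \<noteq> 0 \<or> Y g \<noteq> 0" using XY(1)[of g] by auto
      show ?thesis unfolding XY(3)[of g] cusp_act_cusp_of[OF nz]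
        by (simp add: matrix_mult_22 B_def U_def V_def algebra_simps)
    qed
    finally have "cusp_of (a * U g + b * V g) (c * U g + d * V g) \<in> cusp_orbit \<Gamma> \<aa>"
      using g(2) by (auto simp: cusp_orbit_def N_def intro: rev_image_eqI)
    moreover have "coprime (U g) (V g)"
      using coprime_det_one_image[of 1 "k + 1" k 1, OF _ XY(1)[of g]] by (simp add: U_def V_def)
    ultimately show "\<exists>u v. 1 \<le> u \<and> u \<le> K \<and> 1 \<le> v \<and> v \<le> K \<and> coprime u v
         \<and> cusp_of (a * u + b * v) (c * u + d * v) \<in> cusp_orbit \<Gamma> \<aa>"
      using UV[OF g(1)] K[OF g(1)] by blast
  qed
qed

section \<open>Orbit points between Farey fractions\<close>

definition farey :: "nat \<Rightarrow> real set" where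
  "farey N = {of_int p / of_int q |p q. 0 < q \<and> q \<le> int N}"

definition orbit_points :: "(int^2^2) set \<Rightarrow> cusp \<Rightarrow> real \<Rightarrow> real set" where
  "orbit_points \<Gamma> \<aa> Q = {of_int p / of_int q |p q. 0 < q \<and> of_int q \<le> Q \<and> coprime p q
     \<and> Fin (Fract p q) \<in> cusp_orbit \<Gamma> \<aa>}"

lemma of_int_divide_less:
  fixes a b c d :: int
  assumes "0 < b" "0 < d" "a * d < c * b"
  shows "real_of_int a / of_int b < of_int c / of_int d"
proof -
  have "real_of_int a * of_int d < of_int c * of_int b"
    using assms(3) by (metis of_int_less_iff of_int_mult)
  then show ?thesis using assms(1,2) by (simp add: field_simps)
qed

text \<open>The solutions of the determinant equation form a line in direction
  \<open>(p, q)\<close>, so their denominators fill a residue class modulo \<open>q\<close>, which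
  meets every window of length \<open>q\<close>. For \<open>N \<ge> q\<close> the result is the
  right-hand neighbour of \<open>p / q\<close> in the Farey sequence of order
  \<open>N\<close>.\<close>

lemma farey_neighbour:
  fixes p q :: int
  assumes "coprime p q" "0 < q"
  obtains p' q' where "p' * q - p * q' = 1" "N - q < q'" "q' \<le> N"
proof -
  obtain x y where xy: "x * p + y * q = 1"
    using bezout_int[of p q] assms(1) by auto
  define t where "t = (N + x) div q"
  show thesis
  proof (rule that[of "y + t * p" "t * q - x"])
    show "(y + t * p) * q - p * (t * q - x) = 1" using xy by (simp add: algebra_simps)
    have "t * q - x = N - (N + x) mod q"
      using div_mult_mod_eq[of "N + x" q] unfolding t_def by linarith
    then show "N - q < t * q - x" "t * q - x \<le> N"
      using pos_mod_bound[OF assms(2), of "N + x"] pos_mod_sign[OF assms(2), of "N + x"] by linarith+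
  qed
qed

text \<open>Cramer's rule expresses \<open>b\<close> as a combination of \<open>q\<close> and
  \<open>q'\<close> whose coefficients are positive integers.\<close>

lemma between_neighbours_denominator:
  fixes p q p' q' a b :: int
  assumes det: "p' * q - p * q' = 1" and pos: "0 < q" "0 < q'" "0 < b"
    and gt: "real_of_int p / q < a / b" and lt: "real_of_int a / b < p' / q'"
  shows "q + q' \<le> b"
proof -
  have "real_of_int (p * b) < real_of_int (a * q)"
    using gt pos by (simp add: field_simps)
  then have 1: "1 \<le> a * q - p * b" by linarith
  have "real_of_int (a * q') < real_of_int (p' * b)"
    using lt pos by (simp add: field_simps)
  then have 2: "1 \<le> p' * b - a * q'" by linarith
  have "b = (p' * q - p * q') * b" using det by simp
  also have "\<dots> = q * (p' * b - a * q') + q' * (a * q - p * b)" by (simp add: algebra_simps)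
  finally have "b = q * (p' * b - a * q') + q' * (a * q - p * b)" .
  moreover have "q * 1 \<le> q * (p' * b - a * q')" "q' * 1 \<le> q' * (a * q - p * b)"
    using 1 2 pos by (auto intro!: mult_left_mono)
  ultimately show ?thesis by linarith
qed

lemma rational_lowest_terms:
  fixes p q :: int
  assumes "0 < q"
  obtains a b where "coprime a b" "0 < b" "b \<le> q" "real_of_int p / of_int q = of_int a / of_int b"
proof
  let ?g = "gcd p q"
  have g: "?g > 0" using assms by simp
  show "coprime (p div ?g) (q div ?g)" using assms by (intro div_gcd_coprime) auto
  show "0 < q div ?g" using assms g by (simp add: pos_imp_zdiv_pos_iff zdvd_imp_le)
  have "q div ?g * 1 \<le> q div ?g * ?g"
    using \<open>0 < q div ?g\<close> g by (intro mult_left_mono) linarith+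
  then show "q div ?g \<le> q" by simp
  show "real_of_int p / of_int q = of_int (p div ?g) / of_int (q div ?g)"
    using assms g by (simp add: real_of_int_div)
qed

text \<open>The point is a weighted mediant of \<open>x\<close> and its right neighbour, so no Farey
  fraction separates it from \<open>x\<close>. The last conjunct later makes the assignment of orbit
  points to Farey fractions injective.\<close>

lemma farey_to_orbit:
  assumes K: "K \<ge> 1" and vec: "\<And>a b c d. a * d - b * c = 1 \<Longrightarrow>
       \<exists>u v. 1 \<le> u \<and> u \<le> K \<and> 1 \<le> v \<and> v \<le> K \<and> coprime u v
         \<and> cusp_of (a * u + b * v) (c * u + d * v) \<in> cusp_orbit \<Gamma> \<aa>"
    and x: "x \<in> farey N"
  shows "\<exists>y \<in> orbit_points \<Gamma> \<aa> (2 * of_int K * real N).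
     x < y \<and> y \<le> x + 1 / real N \<and> (\<forall>x'\<in>farey N. x < x' \<longrightarrow> y < x')"
proof -
  obtain p0 q0 where pq0: "x = of_int p0 / of_int q0" "0 < q0" "q0 \<le> int N"
    using x by (auto simp: farey_def)
  obtain p q where pq: "coprime p q" "0 < q" "q \<le> q0" "x = of_int p / of_int q"
    using rational_lowest_terms[OF pq0(2), of p0] pq0(1) by metis
  have qN: "q \<le> int N" using pq pq0 by simp
  obtain p' q' where nb: "p' * q - p * q' = 1" "int N - q < q'" "q' \<le> int N"
    using farey_neighbour[OF pq(1,2)] by blast
  have q': "0 < q'" using nb qN by simp
  obtain u v where uv: "1 \<le> u" "u \<le> K" "1 \<le> v" "v \<le> K" "coprime u v"
    "cusp_of (p' * u + p * v) (q' * u + q * v) \<in> cusp_orbit \<Gamma> \<aa>"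
    using vec[of p' q p q'] nb(1) by blast
  let ?P = "p' * u + p * v" and ?Q = "q' * u + q * v"
  let ?y = "real_of_int ?P / real_of_int ?Q"
  have Q: "0 < ?Q" using uv q' pq by (simp add: add_pos_pos)
  have "q' * u \<le> int N * K" "q * v \<le> int N * K"
    using uv nb(3) qN q' pq(2) by (auto intro!: mult_mono)
  then have QK: "?Q \<le> 2 * K * int N" by (simp add: algebra_simps)
  have "cusp_of ?P ?Q = Fin (Fract ?P ?Q)" using Q by (simp add: cusp_of_def)
  then have "Fin (Fract ?P ?Q) \<in> cusp_orbit \<Gamma> \<aa>" using uv by simp
  moreover have "coprime ?P ?Q"
    using coprime_det_one_image[OF _ uv(5), of p' q p q'] nb(1) by simp
  moreover have "real_of_int ?Q \<le> 2 * of_int K * real N" 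
    using QK by (metis (no_types, lifting) of_int_le_iff of_int_mult of_int_numeral of_int_of_nat_eq)
  ultimately have "?y \<in> orbit_points \<Gamma> \<aa> (2 * of_int K * real N)"
    unfolding orbit_points_def using Q by blast
  moreover have xy: "x < ?y"
  proof -
    have "?P * q = p * ?Q + u * (p' * q - p * q')" by (simp add: algebra_simps)
    then have "p * ?Q < ?P * q" using nb(1) uv by simp
    then show ?thesis unfolding pq(4) using Q pq(2) by (intro of_int_divide_less)
  qed
  moreover have yz: "?y < real_of_int p' / of_int q'"
  proof -
    have "p' * ?Q = ?P * q' + v * (p' * q - p * q')" by (simp add: algebra_simps)
    then have "?P * q' < p' * ?Q" using nb(1) uv by simp
    then show ?thesis using Q q' by (intro of_int_divide_less)
  qed
  moreover have "real_of_int p' / of_int q' \<le> x + 1 / real N"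
  proof -
    \<comment> \<open>The product of \<open>q\<close> and \<open>N - q + 1\<close> is smallest at
      \<open>q = 1\<close> and \<open>q = N\<close>, where it equals \<open>N\<close>; this bounds
      the gap to the neighbour by \<open>1 / N\<close>.\<close>
    have "0 \<le> (q - 1) * (int N - q)" using pq(2) qN by simp
    also have "(q - 1) * (int N - q) = q * (int N - q + 1) - int N" by (simp add: algebra_simps)
    also have "q * (int N - q + 1) \<le> q * q'" using nb(2) pq(2) by (intro mult_left_mono) auto
    finally have "int N \<le> q * q'" by simp
    then have le: "real N \<le> of_int (q * q')" by linarith
    have "real_of_int p' * of_int q - of_int p * of_int q' = of_int (p' * q - p * q')" by simp
    then have "real_of_int p' * of_int q - of_int p * of_int q' = 1" using nb(1) by simp
    then have "real_of_int p' / of_int q' = x + 1 / of_int (q * q')"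
      using q' pq(2) unfolding pq(4) by (simp add: field_simps)
    moreover have "1 / real_of_int (q * q') \<le> 1 / real N"
      using le pq(2) qN by (intro divide_left_mono) (auto simp: q')
    ultimately show ?thesis by simp
  qed
  moreover have "?y < x'" if x': "x' \<in> farey N" "x < x'" for x'
  proof (rule ccontr)
    assume "\<not> ?y < x'"
    then have lt: "x' < real_of_int p' / of_int q'" using yz by simp
    obtain a b where ab: "x' = of_int a / of_int b" "0 < b" "b \<le> int N"
      using x'(1) by (auto simp: farey_def)
    have "q + q' \<le> b"
      using between_neighbours_denominator[OF nb(1) pq(2) q' ab(2)] x'(2) lt unfolding ab(1) pq(4) by blast
    then show False using nb(2) ab(3) by simp
  qed
  ultimately show ?thesis by (intro bexI[of _ ?y]) auto
qed

section \<open>Counting lattice points and reduced fractions in a triangle\<close>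

definition sector :: "real \<Rightarrow> real \<Rightarrow> nat \<Rightarrow> (nat \<times> int) set" where
  "sector a b m = (SIGMA q:{1..m}. {p. a * real q \<le> of_int p \<and> of_int p < b * real q})"

definition reduced_sector :: "real \<Rightarrow> real \<Rightarrow> nat \<Rightarrow> (nat \<times> int) set" where
  "reduced_sector a b m = {(q, p) \<in> sector a b m. coprime p (int q)}"

lemma sector_row: "{p::int. x \<le> of_int p \<and> of_int p < y} = {\<lceil>x\<rceil>..<\<lceil>y\<rceil>}" for x y :: real
  by (auto simp: ceiling_le_iff less_ceiling_iff)

lemma finite_sector [simp]: "finite (sector a b m)"
  by (auto simp: sector_def sector_row)

text \<open>Each row \<open>q\<close> holds \<open>(b - a) * q\<close> integers up to an error of 1,
  and there are \<open>m\<close> rows.\<close>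

lemma card_sector:
  assumes "a < b"
  shows "\<bar>real (card (sector a b m)) - (b - a) * (real m * (real m + 1) / 2)\<bar> \<le> real m"
proof -
  have row: "\<bar>real (nat (\<lceil>b * real q\<rceil> - \<lceil>a * real q\<rceil>)) - (b - a) * real q\<bar> \<le> 1" for q
  proof -
    have "a * real q \<le> b * real q" using assms by (intro mult_right_mono) auto
    then have "\<lceil>a * real q\<rceil> \<le> \<lceil>b * real q\<rceil>" by (rule ceiling_mono)
    then have "real (nat (\<lceil>b * real q\<rceil> - \<lceil>a * real q\<rceil>)) = of_int \<lceil>b * real q\<rceil> - of_int \<lceil>a * real q\<rceil>"
      by simp
    then show ?thesis 
      using ceiling_correct[of "b * real q"] ceiling_correct[of "a * real q"]
      unfolding left_diff_distrib by linarith
  qed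
  have "card (sector a b m) = (\<Sum>q\<in>{1..m}. nat (\<lceil>b * real q\<rceil> - \<lceil>a * real q\<rceil>))"
    unfolding sector_def sector_row by simp
  moreover have "(b - a) * (real m * (real m + 1) / 2) = (\<Sum>q\<in>{1..m}. (b - a) * real q)"
    using double_gauss_sum_from_Suc_0[of m, where 'a = real] unfolding sum_distrib_left[symmetric] by simp
  ultimately have "real (card (sector a b m)) - (b - a) * (real m * (real m + 1) / 2)
     = (\<Sum>q\<in>{1..m}. real (nat (\<lceil>b * real q\<rceil> - \<lceil>a * real q\<rceil>)) - (b - a) * real q)"
    by (simp add: sum_subtractf)
  also have "\<bar>\<dots>\<bar> \<le> (\<Sum>q\<in>{1..m}. 1)" by (rule order_trans[OF sum_abs]) (intro sum_mono row)
  finally show ?thesis by simp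
qed

text \<open>Sort the points by \<open>d = gcd p q\<close> and divide by \<open>d\<close>; the row
  index drops to at most \<open>N div d\<close>.\<close>

lemma card_sector_le_sum_reduced:
  "card (sector a b N) \<le> (\<Sum>d\<in>{1..N}. card (reduced_sector a b (N div d)))"
proof -
  let ?f = "\<lambda>d::nat. \<lambda>(q, p). (d * q, int d * p)"
  have fin: "finite (reduced_sector a b m)" for m
    by (rule finite_subset[OF _ finite_sector[of a b m]]) (auto simp: reduced_sector_def)
  have "sector a b N \<subseteq> (\<Union>d\<in>{1..N}. ?f d ` reduced_sector a b (N div d))"
  proof
    fix z assume "z \<in> sector a b N"
    then obtain q p where z: "z = (q, p)" "1 \<le> q" "q \<le> N" "a * real q \<le> of_int p" "of_int p < b * real q"
      by (auto simp: sector_def)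
    define d where "d = nat (gcd p (int q))"
    have d: "int d = gcd p (int q)" by (simp add: d_def)
    have "gcd p (int q) > 0" using z(2) by auto
    then have d0: "d > 0" using d by linarith
    have "int d dvd int q" "int d dvd p" using d by auto
    then obtain q' p' where q': "q = d * q'" and p': "p = int d * p'"
      by (auto elim!: dvdE simp del: of_nat_dvd_iff simp: int_dvd_int_iff)
    have "gcd p (int q) = int d * gcd p' (int q')" using q' p' by (simp add: gcd_mult_left)
    then have "int d * gcd p' (int q') = int d * 1" using d by simp
    then have cop: "coprime p' (int q')" using d0 by (simp only: mult_cancel_left) (auto simp: coprime_iff_gcd_eq_1)
    have q'0: "q' \<ge> 1" using q' z(2) by (cases q') auto
    have "q' \<le> N div d" using q' z(3) d0 by (metis div_le_mono nonzero_mult_div_cancel_left not_gr0)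
    moreover have "a * real q' \<le> of_int p'" "of_int p' < b * real q'"
    proof -
      have "real d * (a * real q') \<le> real d * of_int p'" "real d * of_int p' < real d * (b * real q')"
        using z(4,5) q' p' by (auto simp: algebra_simps)
      then show "a * real q' \<le> of_int p'" "of_int p' < b * real q'" using d0 by auto
    qed
    ultimately have "(q', p') \<in> reduced_sector a b (N div d)"
      using q'0 cop by (auto simp: reduced_sector_def sector_def)
    moreover have "d \<in> {1..N}"
    proof -
      have "d \<le> q" unfolding q' using q'0 by simp
      then show ?thesis using d0 z(3) by simp
    qed
    ultimately show "z \<in> (\<Union>d\<in>{1..N}. ?f d ` reduced_sector a b (N div d))"
      using z(1) q' p' by (intro UN_I[of d]) (auto intro!: rev_image_eqI)
  qed
  then have "card (sector a b N) \<le> card (\<Union>d\<in>{1..N}. ?f d ` reduced_sector a b (N div d))"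
    using fin by (intro card_mono) auto
  also have "\<dots> \<le> (\<Sum>d\<in>{1..N}. card (?f d ` reduced_sector a b (N div d)))"
    by (rule card_UN_le) simp
  also have "\<dots> \<le> (\<Sum>d\<in>{1..N}. card (reduced_sector a b (N div d)))"
    using fin by (intro sum_mono card_image_le) auto
  finally show ?thesis .
qed

text \<open>Telescoping from the value 1/4 at \<open>N = 2\<close>. What matters is a bound below 1:
  the non-reduced points then cannot exhaust the sector.\<close>

lemma sum_inverse_squares_le: "N \<ge> 2 \<Longrightarrow> (\<Sum>d=2..N. 1 / (real d)\<^sup>2) \<le> 3 / 4 - 1 / real N"
proof (induction N rule: dec_induct)
  case base
  then show ?case by (simp add: power2_eq_square)
next
  case (step n)
  have "1 / (real (Suc n))\<^sup>2 \<le> 1 / (real n * real (Suc n))"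
    using step.hyps by (intro divide_left_mono) (auto simp: power2_eq_square)
  also have "\<dots> = 1 / real n - 1 / real (Suc n)"
    using step.hyps by (simp add: field_simps)
  finally show ?case using step by simp
qed

text \<open>A crude substitute for the logarithm; it only has to make \<open>N\<close> times the sum
  negligible against \<open>N^2\<close>.\<close>

lemma sum_inverse_le: "N \<ge> 1 \<Longrightarrow> (\<Sum>d=2..N. 1 / real d) \<le> 2 * sqrt (real N)"
proof (induction N rule: dec_induct)
  case base
  then show ?case by simp
next
  case (step n)
  let ?s = "sqrt (real n)" and ?t = "sqrt (real (Suc n))"
  have t: "?t \<ge> 1" "?s \<le> ?t" by auto
  have "?t * 1 \<le> ?t * ?t" using t by (intro mult_left_mono) auto
  then have st: "?t + ?s \<le> 2 * (?t * ?t)" using t by linarith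
  have "1 = ?t * ?t - ?s * ?s" by simp
  also have "\<dots> = (?t - ?s) * (?t + ?s)" by (simp add: algebra_simps)
  also have "\<dots> \<le> (?t - ?s) * (2 * (?t * ?t))"
    using t(2) by (intro mult_left_mono st) auto
  finally have "1 / real (Suc n) \<le> 2 * (?t - ?s)"
    by (simp add: field_simps)
  then show ?case using step by simp
qed

text \<open>Subtract the points with \<open>d \<ge> 2\<close> from all points. With
  \<open>l = b - a\<close>, they take at most three quarters of the main term
  \<open>l * N^2 / 2\<close>, which leaves \<open>l * N^2 / 8\<close>; half of that absorbs the
  errors of order \<open>N * sqrt N\<close>.\<close>

lemma card_reduced_sector:
  assumes "a < b"
  shows "\<exists>N0. \<forall>N\<ge>N0. (b - a) * (real N)\<^sup>2 / 16 \<le> card (reduced_sector a b N)"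
proof (intro exI allI impI)
  define l where "l = b - a"
  have l: "l > 0" using assms by (simp add: l_def)
  \<comment> \<open>The threshold gives \<open>16 * (l + 3) / l \<le> sqrt N\<close>, so
    \<open>(l + 3) * N * sqrt N\<close> is at most \<open>l * N^2 / 16\<close>; the spare unit in
    \<open>l + 3\<close> pays for the linear error term.\<close>
  fix N assume N: "N \<ge> nat \<lceil>(16 * (l + 3) / l)\<^sup>2\<rceil> + 2"
  have N2: "N \<ge> 2" using N by simp
  have up: "real (card (sector a b (N div d))) \<le> l * (real N)\<^sup>2 / 2 * (1 / (real d)\<^sup>2) + (l / 2 + 1) * real N * (1 / real d)"
    if "d \<ge> 2" for d
  proof -
    let ?m = "real (N div d)"
    have m: "?m \<le> real N / real d" by (rule of_nat_div_le_of_nat)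
    have "real (card (sector a b (N div d))) \<le> l * (?m * (?m + 1) / 2) + ?m"
      using card_sector[OF assms, of "N div d"] by (simp add: l_def abs_le_iff)
    also have "\<dots> \<le> l * (real N / real d * (real N / real d + 1) / 2) + real N / real d"
      using m l by (intro add_mono mult_left_mono divide_right_mono mult_mono) auto
    also have "\<dots> = l * (real N)\<^sup>2 / 2 * (1 / (real d)\<^sup>2) + (l / 2 + 1) * real N * (1 / real d)"
      using that by (simp add: field_simps power2_eq_square)
    finally show ?thesis .
  qed
  have low: "l * (real N)\<^sup>2 / 2 - real N \<le> card (sector a b N)"
  proof -
    have "l * (real N)\<^sup>2 / 2 \<le> l * (real N * (real N + 1) / 2)"
      using l by (simp add: power2_eq_square algebra_simps)
    then show ?thesis using card_sector[OF assms, of N] by (simp add: l_def abs_le_iff)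
  qed
  have "{1..N} = insert 1 {2..N}" using N2 by auto
  then have "card (sector a b N) \<le> card (reduced_sector a b N) + (\<Sum>d\<in>{2..N}. card (reduced_sector a b (N div d)))"
    using card_sector_le_sum_reduced[of a b N] by simp
  also have "\<dots> \<le> card (reduced_sector a b N) + (\<Sum>d\<in>{2..N}. card (sector a b (N div d)))"
    by (intro add_left_mono sum_mono card_mono) (auto simp: reduced_sector_def)
  finally have "real (card (sector a b N)) \<le> real (card (reduced_sector a b N) + (\<Sum>d\<in>{2..N}. card (sector a b (N div d))))"
    by (rule of_nat_mono)
  then have "real (card (sector a b N)) \<le> card (reduced_sector a b N) + (\<Sum>d\<in>{2..N}. real (card (sector a b (N div d))))"
    by (simp only: of_nat_add of_nat_sum)
  also have "(\<Sum>d\<in>{2..N}. real (card (sector a b (N div d)))) \<le>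
      (\<Sum>d\<in>{2..N}. l * (real N)\<^sup>2 / 2 * (1 / (real d)\<^sup>2) + (l / 2 + 1) * real N * (1 / real d))"
    by (intro sum_mono up) simp
  also have "\<dots> = l * (real N)\<^sup>2 / 2 * (\<Sum>d=2..N. 1 / (real d)\<^sup>2) + (l / 2 + 1) * real N * (\<Sum>d=2..N. 1 / real d)"
    by (simp add: sum.distrib sum_distrib_left)
  also have "\<dots> \<le> l * (real N)\<^sup>2 / 2 * (3 / 4) + (l / 2 + 1) * real N * (2 * sqrt (real N))"
  proof (intro add_mono mult_left_mono)
    have "0 \<le> 1 / real N" by simp
    then show "(\<Sum>d=2..N. 1 / (real d)\<^sup>2) \<le> 3 / 4" using sum_inverse_squares_le[OF N2] by linarith
    show "(\<Sum>d=2..N. 1 / real d) \<le> 2 * sqrt (real N)" using sum_inverse_le N2 by simp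
  qed (use l in auto)
  finally have main: "l * (real N)\<^sup>2 / 8 - real N - (l + 2) * (real N * sqrt (real N)) \<le> card (reduced_sector a b N)"
    using low by (simp add: algebra_simps)
  have "(16 * (l + 3) / l)\<^sup>2 \<le> real N" using N by linarith
  then have "16 * (l + 3) / l \<le> sqrt (real N)" by (rule real_le_rsqrt)
  then have "(l + 3) \<le> l * sqrt (real N) / 16" using l by (simp add: field_simps)
  then have "(l + 3) * (real N * sqrt (real N)) \<le> l * sqrt (real N) / 16 * (real N * sqrt (real N))"
    by (intro mult_right_mono) auto
  also have "\<dots> = l * (real N)\<^sup>2 / 16" by (simp add: power2_eq_square)
  finally have "(l + 2) * (real N * sqrt (real N)) + real N * sqrt (real N) \<le> l * (real N)\<^sup>2 / 16"
    by (simp add: algebra_simps)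
  moreover have "real N * 1 \<le> real N * sqrt (real N)" using N2 by (intro mult_left_mono) auto
  ultimately have "l * (real N)\<^sup>2 / 16 \<le> card (reduced_sector a b N)" using main by linarith
  then show "(b - a) * (real N)\<^sup>2 / 16 \<le> card (reduced_sector a b N)" by (simp add: l_def)
qed

text \<open>Fractions in the left half of the interval are moved to the orbit point just after them.
  For large \<open>N\<close> the shift of at most \<open>1 / N\<close> stays below
  \<open>l / 2\<close>, so nothing leaves the interval; using only half of it turns the constant 16
  into 32.\<close>

lemma orbit_points_dense:
  assumes K: "K \<ge> 1" and vec: "\<And>a b c d. a * d - b * c = 1 \<Longrightarrow>
       \<exists>u v. 1 \<le> u \<and> u \<le> K \<and> 1 \<le> v \<and> v \<le> K \<and> coprime u v
         \<and> cusp_of (a * u + b * v) (c * u + d * v) \<in> cusp_orbit \<Gamma> \<aa>"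
    and l: "l > 0"
  shows "\<exists>N0. \<forall>N\<ge>N0. \<exists>P \<subseteq> orbit_points \<Gamma> \<aa> (2 * of_int K * real N) \<inter> {a..<a + l}.
      finite P \<and> l * (real N)\<^sup>2 / 32 \<le> card P"
proof -
  obtain N0 where N0: "(a + l / 2 - a) * (real N)\<^sup>2 / 16 \<le> card (reduced_sector a (a + l / 2) N)"
    if "N \<ge> N0" for N
    using card_reduced_sector[of a "a + l / 2"] l by auto
  show ?thesis
  proof (intro exI[of _ "max N0 (nat \<lceil>2 / l\<rceil> + 1)"] allI impI)
    fix N assume N: "N \<ge> max N0 (nat \<lceil>2 / l\<rceil> + 1)"
    let ?R = "reduced_sector a (a + l / 2) N"
    have finR: "finite ?R" by (rule finite_subset[OF _ finite_sector]) (auto simp: reduced_sector_def)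
    have "2 / l \<le> real N" using N by linarith
    then have lN: "1 / real N \<le> l / 2" using l N by (simp add: field_simps)
    have "\<forall>x\<in>farey N. \<exists>y. y \<in> orbit_points \<Gamma> \<aa> (2 * of_int K * real N) \<and> x < y \<and> y \<le> x + 1 / real N
        \<and> (\<forall>x'\<in>farey N. x < x' \<longrightarrow> y < x')"
      using farey_to_orbit[OF K vec, where N = N] by blast
    from bchoice[OF this] obtain \<phi> where
      \<phi>: "\<And>x. x \<in> farey N \<Longrightarrow> \<phi> x \<in> orbit_points \<Gamma> \<aa> (2 * of_int K * real N)"
        "\<And>x. x \<in> farey N \<Longrightarrow> x < \<phi> x" "\<And>x. x \<in> farey N \<Longrightarrow> \<phi> x \<le> x + 1 / real N"
        "\<And>x x'. x \<in> farey N \<Longrightarrow> x' \<in> farey N \<Longrightarrow> x < x' \<Longrightarrow> \<phi> x < x'" by blast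
    have inj: "inj_on \<phi> (farey N)"
    proof (rule inj_onI)
      fix x x' assume "x \<in> farey N" "x' \<in> farey N" "\<phi> x = \<phi> x'"
      then show "x = x'" using \<phi>(2)[of x] \<phi>(2)[of x'] \<phi>(4)[of x x'] \<phi>(4)[of x' x] by linarith
    qed
    let ?f = "\<lambda>(q, p). real_of_int p / real q"
    have injf: "inj_on ?f ?R"
    proof (rule inj_onI)
      fix x x' assume x: "x \<in> ?R" "x' \<in> ?R" "?f x = ?f x'"
      obtain q p q' p' where e: "x = (q, p)" "x' = (q', p')" by fastforce
      have q: "q \<ge> 1" "q' \<ge> 1" "coprime p (int q)" "coprime p' (int q')"
        using x(1,2) e by (auto simp: reduced_sector_def sector_def)
      have "real_of_int (p * int q') = real_of_int (p' * int q)" using x(3) q e by (simp add: field_simps)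
      then have eq: "p * int q' = p' * int q" by (simp only: of_int_eq_iff)
      then have "\<bar>p\<bar> * \<bar>int q'\<bar> = \<bar>p'\<bar> * \<bar>int q\<bar>" by (simp only: abs_mult[symmetric])
      then have "q = q'" using coprime_crossproduct_int[OF q(3,4), of] by simp
      then show "x = x'" using eq q(1) e by simp
    qed
    have fR: "?f ` ?R \<subseteq> farey N \<inter> {a..<a + l / 2}"
    proof safe
      fix q p assume qp: "(q, p) \<in> ?R"
      then have q: "1 \<le> q" "q \<le> N" "a * real q \<le> of_int p" "of_int p < (a + l / 2) * real q"
        by (auto simp: reduced_sector_def sector_def)
      show "real_of_int p / real q \<in> farey N" unfolding farey_def
        using q by (intro CollectI exI[of _ p] exI[of _ "int q"]) auto
      show "real_of_int p / real q \<in> {a..<a + l / 2}" using q 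
        by (auto simp: pos_le_divide_eq pos_divide_less_eq)
    qed
    show "\<exists>P \<subseteq> orbit_points \<Gamma> \<aa> (2 * of_int K * real N) \<inter> {a..<a + l}.
      finite P \<and> l * (real N)\<^sup>2 / 32 \<le> card P"
    proof (intro exI[of _ "\<phi> ` ?f ` ?R"] conjI)
      show "\<phi> ` ?f ` ?R \<subseteq> orbit_points \<Gamma> \<aa> (2 * of_int K * real N) \<inter> {a..<a + l}"
      proof
        fix y assume "y \<in> \<phi> ` ?f ` ?R"
        then obtain x where x: "x \<in> farey N" "a \<le> x" "x < a + l / 2" "y = \<phi> x" using fR by fastforce
        then show "y \<in> orbit_points \<Gamma> \<aa> (2 * of_int K * real N) \<inter> {a..<a + l}"
          using \<phi>[OF x(1)] lN by auto
      qed
      show "finite (\<phi> ` ?f ` ?R)" using finR by simp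
      have "card (\<phi> ` ?f ` ?R) = card ?R"
        using inj injf fR by (simp add: card_image inj_on_subset)
      then show "l * (real N)\<^sup>2 / 32 \<le> card (\<phi> ` ?f ` ?R)" using N0[of N] N by simp
    qed
  qed
qed

lemma orbit_points_separated:
  assumes "x \<in> orbit_points \<Gamma> \<aa> Q" "y \<in> orbit_points \<Gamma> \<aa> Q" "x \<noteq> y"
  shows "1 / Q\<^sup>2 \<le> \<bar>x - y\<bar>"
proof -
  obtain p q where x: "x = of_int p / of_int q" "0 < q" "of_int q \<le> Q"
    using assms(1) by (auto simp: orbit_points_def)
  obtain p' q' where y: "y = of_int p' / of_int q'" "0 < q'" "of_int q' \<le> Q"
    using assms(2) by (auto simp: orbit_points_def)
  have eq: "x - y = of_int (p * q' - p' * q) / of_int (q * q')"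
    unfolding x(1) y(1) using x(2) y(2) by (simp add: field_simps)
  have "p * q' - p' * q \<noteq> 0"
  proof
    assume "p * q' - p' * q = 0"
    then have "x - y = 0" unfolding eq by (simp only: of_int_0 div_0)
    then show False using assms(3) by simp
  qed
  then have 1: "1 \<le> \<bar>real_of_int (p * q' - p' * q)\<bar>" by linarith
  have "real_of_int (q * q') \<le> Q\<^sup>2"
    using x y unfolding of_int_mult power2_eq_square by (intro mult_mono) auto
  then have "1 / Q\<^sup>2 \<le> 1 / of_int (q * q')"
    using x(2) y(2) x(3) by (intro divide_left_mono) auto
  also have "\<dots> \<le> \<bar>x - y\<bar>"
    unfolding eq abs_divide using 1 x(2) y(2) by (auto intro!: divide_right_mono)
  finally show ?thesis .
qed

section \<open>Dyadic cells and net content\<close>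

text \<open>Half-open, so that the cells of one generation partition the line, any two cells are
  nested or disjoint, and membership is decided by a floor.\<close>

definition cell :: "nat \<times> int \<Rightarrow> real set" where
  "cell D = {of_int (snd D) / 2 ^ fst D ..< (of_int (snd D) + 1) / 2 ^ fst D}"

text \<open>With \<open>\<alpha> = 2 powr (- s)\<close> the weight \<open>\<alpha> ^ fst D\<close>
  is the s-th power of the length of the cell, so this bounds the dyadic net content of
  \<open>E\<close> from below. Only finite covers are tested, which is what compactness will
  supply.\<close>

definition content_ge :: "real \<Rightarrow> real \<Rightarrow> real set \<Rightarrow> bool" where
  "content_ge \<alpha> w E \<longleftrightarrow> (\<forall>\<D>. finite \<D> \<longrightarrow> E \<subseteq> \<Union>(cell ` \<D>) \<longrightarrow> w \<le> (\<Sum>D\<in>\<D>. \<alpha> ^ fst D))"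

lemma mem_cell_iff: "x \<in> cell D \<longleftrightarrow> \<lfloor>x * 2 ^ fst D\<rfloor> = snd D"
  by (auto simp: cell_def floor_eq_iff field_simps)

text \<open>The coarser floor is the integer quotient of the finer one by a power of 2.\<close>

lemma floor_mult_power2_mono:
  fixes x y :: real
  assumes "k \<le> m" "\<lfloor>x * 2 ^ m\<rfloor> = \<lfloor>y * 2 ^ m\<rfloor>"
  shows "\<lfloor>x * 2 ^ k\<rfloor> = \<lfloor>y * 2 ^ k\<rfloor>"
proof -
  have "\<lfloor>z * 2 ^ k\<rfloor> = \<lfloor>z * 2 ^ m\<rfloor> div 2 ^ (m - k)" for z :: real
  proof -
    obtain d where d: "m = k + d" using assms(1) by (auto simp: le_iff_add)
    have "z * 2 ^ k = z * 2 ^ m / of_int (2 ^ (m - k))"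
      unfolding d by (simp add: power_add)
    then show ?thesis using floor_divide_real_eq_div[of "2 ^ (m - k)" "z * 2 ^ m"] by simp
  qed
  then show ?thesis using assms(2) by simp
qed

lemma cell_nested:
  assumes "cell D \<inter> cell E \<noteq> {}" "fst D \<le> fst E"
  shows "cell E \<subseteq> cell D"
proof
  fix y assume y: "y \<in> cell E"
  obtain x where "x \<in> cell D" "x \<in> cell E" using assms(1) by blast
  then show "y \<in> cell D"
    using floor_mult_power2_mono[OF assms(2), of x y] y by (auto simp: mem_cell_iff)
qed

lemma cell_nonempty: "cell D \<noteq> {}"
  by (simp add: cell_def divide_strict_right_mono)

lemma sets_cell [measurable]: "cell D \<in> sets lborel"
  by (simp add: cell_def)

lemma fmeasurable_cell: "cell D \<in> fmeasurable lborel"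
  by (rule fmeasurableI) (auto simp: cell_def divide_right_mono)

lemma measure_cell: "measure lborel (cell D) = 1 / 2 ^ fst D"
  by (simp add: cell_def divide_right_mono diff_divide_distrib[symmetric])

lemma cell_children: "cell (k, i) = cell (Suc k, 2 * i) \<union> cell (Suc k, 2 * i + 1)"
  by (auto simp: cell_def field_simps)

lemma cell_children_disjoint: "cell (Suc k, 2 * i) \<inter> cell (Suc k, 2 * i + 1) = {}"
  by (auto simp: mem_cell_iff)

lemma content_geD: "content_ge \<alpha> w E \<Longrightarrow> finite \<D> \<Longrightarrow> E \<subseteq> \<Union>(cell ` \<D>) \<Longrightarrow> w \<le> (\<Sum>D\<in>\<D>. \<alpha> ^ fst D)"
  by (auto simp: content_ge_def)

lemma card_separated_le:
  fixes P :: "real set"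
  assumes "\<delta> > 0" "L \<ge> 0" "P \<subseteq> {a..<a + L}" "\<And>x y. x \<in> P \<Longrightarrow> y \<in> P \<Longrightarrow> x \<noteq> y \<Longrightarrow> \<delta> \<le> \<bar>x - y\<bar>"
  shows "real (card P) \<le> L / \<delta> + 1"
proof -
  let ?f = "\<lambda>x. \<lfloor>(x - a) / \<delta>\<rfloor>"
  have "inj_on ?f P"
  proof (rule inj_onI, rule ccontr)
    fix x y assume xy: "x \<in> P" "y \<in> P" "?f x = ?f y" "x \<noteq> y"
    have "\<bar>(x - a) / \<delta> - (y - a) / \<delta>\<bar> < 1" using xy(3) by linarith
    also have "(x - a) / \<delta> - (y - a) / \<delta> = (x - y) / \<delta>" by (simp add: diff_divide_distrib)
    finally show False using assms(1) assms(4)[OF xy(1,2,4)] by simp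
  qed
  moreover have "?f ` P \<subseteq> {0..\<lfloor>L / \<delta>\<rfloor>}"
  proof safe
    fix x assume "x \<in> P"
    then have "0 \<le> x - a" "x - a \<le> L" using assms(3) by force+
    then have "0 \<le> (x - a) / \<delta>" "(x - a) / \<delta> \<le> L / \<delta>" using assms(1) by (auto intro: divide_right_mono)
    then show "?f x \<in> {0..\<lfloor>L / \<delta>\<rfloor>}" by (simp add: floor_mono)
  qed
  ultimately have "card P \<le> card {0..\<lfloor>L / \<delta>\<rfloor>}"
    by (metis card_inj_on_le finite_atLeastAtMost_int)
  moreover have "real (card {0..\<lfloor>L / \<delta>\<rfloor>}) \<le> L / \<delta> + 1"
    using assms(1,2) by simp
  ultimately show ?thesis by linarith
qed

lemma sum_geometric_tail_le:
  fixes \<alpha> :: real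
  assumes "0 < \<alpha>" "\<alpha> < 1" "finite S" "\<And>k. k \<in> S \<Longrightarrow> m \<le> k"
  shows "(\<Sum>k\<in>S. \<alpha> ^ k) \<le> \<alpha> ^ m / (1 - \<alpha>)"
proof -
  obtain M where M: "S \<subseteq> {..<M}" using finite_nat_iff_bounded[of S] assms(3) by blast
  have "S \<subseteq> {m..<m + M}" using M assms(4) by force
  then have "(\<Sum>k\<in>S. \<alpha> ^ k) \<le> (\<Sum>k\<in>{m..<m + M}. \<alpha> ^ k)"
    using assms(1) by (intro sum_mono2) auto
  also have "\<dots> = (\<alpha> ^ m - \<alpha> ^ (m + M)) / (1 - \<alpha>)"
  proof -
    have "(\<Sum>k\<in>{m..<m + M}. \<alpha> ^ k) * (1 - \<alpha>) = \<alpha> ^ m - \<alpha> ^ (m + M)"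
    proof (induction M)
      case (Suc M)
      have "(\<Sum>k\<in>{m..<m + Suc M}. \<alpha> ^ k) * (1 - \<alpha>) = (\<Sum>k\<in>{m..<m + M}. \<alpha> ^ k) * (1 - \<alpha>) + \<alpha> ^ (m + M) * (1 - \<alpha>)"
        by (simp add: distrib_right)
      also have "\<dots> = \<alpha> ^ m - \<alpha> ^ (m + M) + \<alpha> ^ (m + M) * (1 - \<alpha>)" by (simp only: Suc)
      finally show ?case by (simp add: right_diff_distrib)
    qed simp
    then show ?thesis using assms(2) by (simp add: eq_divide_eq)
  qed
  also have "\<dots> \<le> \<alpha> ^ m / (1 - \<alpha>)" using assms(1,2) by (intro divide_right_mono) auto
  finally show ?thesis .
qed

section \<open>A Frostman bound for masses next to separated points\<close>

text \<open>The cell containing \<open>r\<close> is skipped, so that \<open>r\<close> is strictly to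
  the left even when it is a dyadic endpoint.\<close>

definition successor_cell :: "nat \<Rightarrow> real \<Rightarrow> nat \<times> int" where
  "successor_cell k r = (k, \<lfloor>r * 2 ^ k\<rfloor> + 1)"

lemma successor_cell_bounds:
  "fst (successor_cell k r) = k"
  "r < of_int (snd (successor_cell k r)) / 2 ^ k"
  "(of_int (snd (successor_cell k r)) + 1) / 2 ^ k \<le> r + 2 / 2 ^ k"
proof -
  have "r * 2 ^ k < of_int \<lfloor>r * 2 ^ k\<rfloor> + 1" "of_int \<lfloor>r * 2 ^ k\<rfloor> \<le> r * 2 ^ k" by linarith+
  then show "r < of_int (snd (successor_cell k r)) / 2 ^ k"
    "(of_int (snd (successor_cell k r)) + 1) / 2 ^ k \<le> r + 2 / 2 ^ k"
    by (simp_all add: successor_cell_def field_simps)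
qed (simp add: successor_cell_def)

lemma successor_cell_subset:
  "cell (successor_cell k r) \<subseteq> {r<..<r + 2 / 2 ^ k}"
  using successor_cell_bounds(2,3)[where k = k and r = r] by (auto simp: cell_def successor_cell_bounds(1))

text \<open>Each point spreads mass \<open>\<alpha> ^ k\<close> uniformly over its successor cell,
  with density \<open>\<alpha> ^ k * 2 ^ k\<close>. For a coarse cell \<open>D\<close> the separated
  points near it are counted; for a fine one the same count is combined with the bound
  \<open>1 / 2 ^ fst D\<close> for each overlap. The sum runs over points, so a cell serving several
  points carries several masses.\<close>

lemma one_scale_mass_le:
  fixes \<alpha> K :: real
  assumes \<alpha>: "1 / 2 < \<alpha>" "\<alpha> < 1" and K: "K \<ge> 1" and N: "N \<ge> 1" "(real N)\<^sup>2 * \<alpha> ^ k \<le> 1"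
    and P: "finite P" "\<And>x y. x \<in> P \<Longrightarrow> y \<in> P \<Longrightarrow> x \<noteq> y \<Longrightarrow> 1 / (K * real N)\<^sup>2 \<le> \<bar>x - y\<bar>"
  shows "(\<Sum>r\<in>P. \<alpha> ^ k * 2 ^ k * measure lborel (cell (successor_cell k r) \<inter> cell D))
    \<le> K\<^sup>2 * (if fst D \<le> k then 1 / 2 ^ fst D + 3 * \<alpha> ^ k else 4 * (2 * \<alpha>) ^ k / 2 ^ fst D)"
proof -
  define m where "m = fst D"
  define P' where "P' = {r \<in> P. cell (successor_cell k r) \<inter> cell D \<noteq> {}}"
  \<comment> \<open>A point whose successor cell meets \<open>D\<close> lies in \<open>D\<close> or
    less than \<open>2 / 2 ^ k\<close> to its left; \<open>L\<close> is the length of this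
    window.\<close>
  define L :: real where "L = 1 / 2 ^ m + 2 / 2 ^ k"
  let ?a = "of_int (snd D) / 2 ^ m - 2 / 2 ^ k :: real"
  have K2: "1 \<le> K\<^sup>2" using K by (simp add: one_le_power)
  have ak: "(1 / 2) ^ k \<le> \<alpha> ^ k" using \<alpha> by (intro power_mono) auto
  have sub: "P' \<subseteq> {?a..<?a + L}"
  proof
    fix r assume "r \<in> P'"
    then obtain x where x: "x \<in> cell (successor_cell k r)" "x \<in> cell D" by (auto simp: P'_def)
    have "r < x" "x < r + 2 / 2 ^ k" using x(1) successor_cell_subset[of k r] by auto
    moreover have "of_int (snd D) / 2 ^ m \<le> x" "x < of_int (snd D) / 2 ^ m + 1 / 2 ^ m"
      using x(2) by (auto simp: cell_def m_def add_divide_distrib)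
    ultimately show "r \<in> {?a..<?a + L}" by (auto simp: L_def)
  qed
  have "real (card P') \<le> L / (1 / (K * real N)\<^sup>2) + 1"
    using K N P(2) sub by (intro card_separated_le[of _ _ _ ?a]) (auto simp: P'_def L_def)
  then have "\<alpha> ^ k * real (card P') \<le> \<alpha> ^ k * (L * (K\<^sup>2 * (real N)\<^sup>2) + 1)"
    using \<alpha> by (intro mult_left_mono) (auto simp: power_mult_distrib)
  also have "\<dots> = L * K\<^sup>2 * ((real N)\<^sup>2 * \<alpha> ^ k) + \<alpha> ^ k" by (simp add: algebra_simps)
  also have "\<dots> \<le> L * K\<^sup>2 * 1 + K\<^sup>2 * \<alpha> ^ k"
    using N(2) K2 \<alpha> by (intro add_mono mult_left_mono) (auto simp: L_def)
  also have "\<dots> = K\<^sup>2 * (L + \<alpha> ^ k)" by (simp add: algebra_simps)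
  \<comment> \<open>Of the 3, two come from the widened window, since
    \<open>1 / 2 ^ k \<le> \<alpha> ^ k\<close>, and one from the additional point in the separation
    count.\<close>
  also have "\<dots> \<le> K\<^sup>2 * (1 / 2 ^ m + 3 * \<alpha> ^ k)"
    using K2 ak by (intro mult_left_mono) (auto simp: L_def power_one_over)
  finally have cnt: "\<alpha> ^ k * real (card P') \<le> K\<^sup>2 * (1 / 2 ^ m + 3 * \<alpha> ^ k)" .
  define M where "M = 1 / (2::real) ^ max k m"
  have "measure lborel (cell (successor_cell k r) \<inter> cell D) \<le> M" for r
  proof -
    have "measure lborel (cell (successor_cell k r) \<inter> cell D) \<le> measure lborel (cell (successor_cell k r))"
      "measure lborel (cell (successor_cell k r) \<inter> cell D) \<le> measure lborel (cell D)"
      by (intro measure_mono_fmeasurable fmeasurable_cell; simp)+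
    then show ?thesis by (auto simp: measure_cell successor_cell_bounds(1) m_def M_def max_def)
  qed
  then have "(\<Sum>r\<in>P'. \<alpha> ^ k * 2 ^ k * measure lborel (cell (successor_cell k r) \<inter> cell D))
      \<le> (\<Sum>r\<in>P'. \<alpha> ^ k * 2 ^ k * M)"
    using \<alpha> by (intro sum_mono mult_left_mono) auto
  moreover have "(\<Sum>r\<in>P'. \<alpha> ^ k * 2 ^ k * measure lborel (cell (successor_cell k r) \<inter> cell D))
      = (\<Sum>r\<in>P. \<alpha> ^ k * 2 ^ k * measure lborel (cell (successor_cell k r) \<inter> cell D))"
    using P(1) by (intro sum.mono_neutral_left) (auto simp: P'_def)
  moreover have "(\<Sum>r\<in>P'. \<alpha> ^ k * 2 ^ k * M) = \<alpha> ^ k * real (card P') * (2 ^ k * M)" by simp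
  moreover have "\<alpha> ^ k * real (card P') * (2 ^ k * M) \<le> K\<^sup>2 * (1 / 2 ^ m + 3 * \<alpha> ^ k) * (2 ^ k * M)"
    by (intro mult_right_mono cnt) (simp add: M_def)
  ultimately have le: "(\<Sum>r\<in>P. \<alpha> ^ k * 2 ^ k * measure lborel (cell (successor_cell k r) \<inter> cell D))
      \<le> K\<^sup>2 * (1 / 2 ^ m + 3 * \<alpha> ^ k) * (2 ^ k * M)" by linarith
  show ?thesis
  proof (cases "m \<le> k")
    case True
    then show ?thesis using le by (simp add: M_def m_def max_def)
  next
    case False
    then have "1 / 2 ^ m \<le> (1 / 2 :: real) ^ k" by (simp add: power_one_over frac_le)
    then have "1 / 2 ^ m \<le> \<alpha> ^ k" using ak by linarith
    then have "K\<^sup>2 * (1 / 2 ^ m + 3 * \<alpha> ^ k) * (2 ^ k * M) \<le> K\<^sup>2 * (4 * \<alpha> ^ k) * (2 ^ k * M)"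
      using K2 by (intro mult_right_mono mult_left_mono) (auto simp: M_def)
    also have "\<dots> = K\<^sup>2 * (4 * (2 * \<alpha>) ^ k / 2 ^ m)"
      using False by (simp add: M_def max_def power_mult_distrib)
    finally show ?thesis using le False by (simp add: m_def)
  qed
qed

text \<open>Summed over all scales, a cell receives at most a multiple of the s-th power of its
  length, which is the Frostman condition. Scales \<open>k \<ge> m\<close> contribute
  \<open>n / 2 ^ m\<close> and a decaying geometric series; the number \<open>n\<close> of scales is
  as large as the first of these permits. Scales \<open>k < m\<close> form a geometric series of
  ratio \<open>2 * \<alpha> > 1\<close>, dominated by its last term.\<close>

lemma sum_one_scale_bounds:
  fixes \<alpha> :: real
  assumes \<alpha>: "1 / 2 < \<alpha>" "\<alpha> < 1" and n: "real n \<le> 2 * (2 * \<alpha>) ^ m0" and m: "m0 \<le> m"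
  shows "(\<Sum>k\<in>{k0..<k0 + n}. if m \<le> k then 1 / 2 ^ m + 3 * \<alpha> ^ k else 4 * (2 * \<alpha>) ^ k / 2 ^ m)
    \<le> (2 + 3 / (1 - \<alpha>) + 4 / (2 * \<alpha> - 1)) * \<alpha> ^ m"
proof -
  let ?S = "{k0..<k0 + n}"
  have "(\<Sum>k\<in>?S. if m \<le> k then 1 / 2 ^ m + 3 * \<alpha> ^ k else 4 * (2 * \<alpha>) ^ k / 2 ^ m)
    = (\<Sum>k\<in>?S \<inter> {k. m \<le> k}. 1 / 2 ^ m + 3 * \<alpha> ^ k) + (\<Sum>k\<in>?S \<inter> - {k. m \<le> k}. 4 * (2 * \<alpha>) ^ k / 2 ^ m)"
    by (rule sum.If_cases) simp
  also have "(\<Sum>k\<in>?S \<inter> {k. m \<le> k}. 1 / 2 ^ m + 3 * \<alpha> ^ k)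
    = real (card (?S \<inter> {k. m \<le> k})) * (1 / 2 ^ m) + 3 * (\<Sum>k\<in>?S \<inter> {k. m \<le> k}. \<alpha> ^ k)"
    by (simp add: sum.distrib sum_distrib_left)
  also have "\<dots> \<le> real n * (1 / 2 ^ m) + 3 * (\<alpha> ^ m / (1 - \<alpha>))"
  proof (intro add_mono mult_right_mono mult_left_mono)
    show "real (card (?S \<inter> {k. m \<le> k})) \<le> real n"
      using card_mono[of ?S "?S \<inter> {k. m \<le> k}"] by simp
    show "(\<Sum>k\<in>?S \<inter> {k. m \<le> k}. \<alpha> ^ k) \<le> \<alpha> ^ m / (1 - \<alpha>)"
      using \<alpha> by (intro sum_geometric_tail_le) auto
  qed auto
  also have "real n * (1 / 2 ^ m) \<le> 2 * (2 * \<alpha>) ^ m * (1 / 2 ^ m)"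
  proof (intro mult_right_mono)
    have "(2 * \<alpha>) ^ m0 \<le> (2 * \<alpha>) ^ m" using \<alpha> m by (intro power_increasing) auto
    then show "real n \<le> 2 * (2 * \<alpha>) ^ m" using n by linarith
  qed simp
  also have "\<dots> = 2 * \<alpha> ^ m" by (simp add: power_mult_distrib)
  also have "(\<Sum>k\<in>?S \<inter> - {k. m \<le> k}. 4 * (2 * \<alpha>) ^ k / 2 ^ m) \<le> (\<Sum>k\<in>{..<m}. 4 * (2 * \<alpha>) ^ k / 2 ^ m)"
    using \<alpha> by (intro sum_mono2) auto
  also have "\<dots> = 4 / 2 ^ m * (\<Sum>k\<in>{..<m}. (2 * \<alpha>) ^ k)" by (simp add: sum_distrib_left)
  also have "\<dots> = 4 / 2 ^ m * (((2 * \<alpha>) ^ m - 1) / (2 * \<alpha> - 1))"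
    using \<alpha> by (subst geometric_sum) auto
  also have "\<dots> \<le> 4 / 2 ^ m * ((2 * \<alpha>) ^ m / (2 * \<alpha> - 1))"
    using \<alpha> by (intro mult_left_mono divide_right_mono) auto
  also have "\<dots> = 4 / (2 * \<alpha> - 1) * \<alpha> ^ m" by (simp add: power_mult_distrib)
  finally show ?thesis by (simp add: algebra_simps)
qed

text \<open>\<open>N k\<close> is the integer part of \<open>\<alpha> powr (- k / 2)\<close>, the
  order for which cells of generation \<open>k\<close> have length about
  \<open>N powr (- 2 / s)\<close>. Rounding down a number that is at least 1 costs at most a factor
  2, hence the 1/4.\<close>

lemma exists_denominator:
  fixes \<alpha> :: real
  assumes "0 < \<alpha>" "\<alpha> < 1"
  obtains N :: "nat \<Rightarrow> nat" where "\<And>k. (real (N k))\<^sup>2 * \<alpha> ^ k \<le> 1" "\<And>k. 1 / 4 \<le> (real (N k))\<^sup>2 * \<alpha> ^ k"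
    "\<And>k. N k \<ge> 1" "filterlim N at_top at_top"
proof
  define x where "x k = sqrt ((1 / \<alpha>) ^ k)" for k
  define N where "N k = nat \<lfloor>x k\<rfloor>" for k
  have ge1: "1 \<le> x k" for k
    unfolding x_def using assms by (simp add: one_le_power)
  have x2: "(x k)\<^sup>2 * \<alpha> ^ k = 1" for k
    using assms by (simp add: x_def power_one_over)
  have N: "1 \<le> N k" "real (N k) \<le> x k" "x k / 2 \<le> real (N k)" for k
  proof -
    have "1 \<le> \<lfloor>x k\<rfloor>" using ge1[of k] by linarith
    then show "1 \<le> N k" "real (N k) \<le> x k" "x k / 2 \<le> real (N k)"
      unfolding N_def by linarith+
  qed
  show "N k \<ge> 1" for k by (rule N)
  show "(real (N k))\<^sup>2 * \<alpha> ^ k \<le> 1" for k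
  proof -
    have "(real (N k))\<^sup>2 * \<alpha> ^ k \<le> (x k)\<^sup>2 * \<alpha> ^ k"
      using assms N by (intro mult_right_mono power_mono) auto
    then show ?thesis using x2 by simp
  qed
  show "1 / 4 \<le> (real (N k))\<^sup>2 * \<alpha> ^ k" for k
  proof -
    have "(x k / 2)\<^sup>2 * \<alpha> ^ k \<le> (real (N k))\<^sup>2 * \<alpha> ^ k"
      using assms N ge1[of k] by (intro mult_right_mono power_mono) auto
    then show ?thesis using x2[of k] by (simp add: power_divide)
  qed
  have "filterlim (\<lambda>k. (1 / \<alpha>) ^ k) at_top sequentially"
    using filterlim_at_infinity_imp_norm_at_top[OF filterlim_realpow_sequentially_gt1[of "1 / \<alpha>"]] assms
    by (simp add: norm_power)
  then have "filterlim x at_top sequentially"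
    unfolding x_def by (rule filterlim_compose[OF sqrt_at_top])
  then show "filterlim N at_top at_top"
    unfolding N_def by (intro filterlim_compose[OF filterlim_nat_sequentially] filterlim_compose[OF filterlim_floor_sequentially])
qed

section \<open>Transference from ubiquity to full net content\<close>

text \<open>The point \<open>r\<close> lies strictly to the left of the cell, so that a point in infinitely many such
  cells has infinitely many distinct approximants.\<close>

definition near_cell :: "real \<Rightarrow> (nat \<Rightarrow> real set) \<Rightarrow> nat \<times> int \<Rightarrow> bool" where
  "near_cell \<alpha> X J \<longleftrightarrow> (\<exists>N r. r \<in> X N \<and> (real N)\<^sup>2 * \<alpha> ^ fst J \<le> 1
     \<and> r < of_int (snd J) / 2 ^ fst J \<and> (of_int (snd J) + 1) / 2 ^ fst J \<le> r + 2 / 2 ^ fst J)"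

text \<open>\<open>c\<close> is the captured fraction of the weight of \<open>I\<close> itself.
  Arbitrarily deep generations allow iteration, and finiteness of \<open>G\<close> keeps every stage
  compact after closing the cells.\<close>

definition fills :: "real \<Rightarrow> (nat \<Rightarrow> real set) \<Rightarrow> real \<Rightarrow> bool" where
  "fills \<alpha> X c \<longleftrightarrow> (\<forall>I n. \<exists>G. finite G \<and> (\<forall>J\<in>G. n \<le> fst J \<and> cell J \<subseteq> cell I \<and> near_cell \<alpha> X J)
     \<and> content_ge \<alpha> (c * \<alpha> ^ fst I) (\<Union>(cell ` G)))"

text \<open>The mass distribution principle: the total mass in \<open>I\<close> is at least
  \<open>c * \<alpha> ^ m0 / 8\<close>, and no cell of generation at least \<open>m0\<close> carries
  more than \<open>C\<close> times its weight, so a cover by such cells weighs at least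
  \<open>c / (8 * C) * \<alpha> ^ m0\<close>. A cover with a larger cell is already expensive
  enough.\<close>

lemma ubiquity_fills:
  fixes X :: "nat \<Rightarrow> real set" and \<alpha> K c :: real
  assumes \<alpha>: "1 / 2 < \<alpha>" "\<alpha> < 1" and K: "K \<ge> 1" and c: "c > 0"
    and sep: "\<And>N x y. x \<in> X N \<Longrightarrow> y \<in> X N \<Longrightarrow> x \<noteq> y \<Longrightarrow> 1 / (K * real N)\<^sup>2 \<le> \<bar>x - y\<bar>"
    and dense: "\<And>a l. l > 0 \<Longrightarrow> \<exists>N0. \<forall>N\<ge>N0. \<exists>P \<subseteq> X N \<inter> {a..<a + l}. finite P \<and> c * l * (real N)\<^sup>2 \<le> card P"
  shows "\<exists>c0>0. fills \<alpha> X c0"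
proof -
  define C where "C = K\<^sup>2 * (2 + 3 / (1 - \<alpha>) + 4 / (2 * \<alpha> - 1))"
  have C: "C > 0" using \<alpha> K by (auto simp: C_def intro!: mult_pos_pos add_pos_pos)
  \<comment> \<open>The 8 consists of a 2, for the half of \<open>I\<close> in use, and a 4, from
    the lower bound 1/4 for \<open>N^2 * \<alpha> ^ k\<close>. The cap at 1 serves covers that
    contain a cell longer than \<open>I\<close>.\<close>
  define c0 where "c0 = min 1 (c / (8 * C))"
  have c0: "c0 > 0" using c C by (simp add: c0_def)
  obtain N where N: "\<And>k. (real (N k))\<^sup>2 * \<alpha> ^ k \<le> 1" "\<And>k. 1 / 4 \<le> (real (N k))\<^sup>2 * \<alpha> ^ k"
    "\<And>k::nat. N k \<ge> 1" "filterlim N at_top at_top"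
    using exists_denominator[of \<alpha>] \<alpha> by (metis less_trans zero_less_divide_1_iff zero_less_numeral)
  have "\<exists>G. finite G \<and> (\<forall>J\<in>G. n0 \<le> fst J \<and> cell J \<subseteq> cell I \<and> near_cell \<alpha> X J)
     \<and> content_ge \<alpha> (c0 * \<alpha> ^ fst I) (\<Union>(cell ` G))" for I n0
  proof -
    define m0 where "m0 = fst I"
    define l :: real where "l = 1 / 2 ^ m0"
    define a :: real where "a = of_int (snd I) / 2 ^ m0"
    have l: "l > 0" by (simp add: l_def)
    have cellI: "cell I = {a..<a + l}"
      by (simp add: cell_def a_def l_def m0_def add_divide_distrib)
    obtain N0 where N0: "\<And>N. N \<ge> N0 \<Longrightarrow> \<exists>P \<subseteq> X N \<inter> {a..<a + l / 2}. finite P \<and> c * (l / 2) * (real N)\<^sup>2 \<le> card P"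
      using dense[of "l / 2" a] l by auto
    have "eventually (\<lambda>k. N k \<ge> N0) at_top" using N(4) by (simp add: filterlim_at_top)
    then obtain k1 where k1: "\<And>k. k \<ge> k1 \<Longrightarrow> N k \<ge> N0" by (auto simp: eventually_at_top_linorder)
    \<comment> \<open>Beyond \<open>k1\<close> the orders \<open>N k\<close> are large enough for
      the density hypothesis, \<open>n0\<close> is the demanded depth, and \<open>m0 + 2\<close>
      keeps the successor cell of a point in the left half of \<open>I\<close> inside
      \<open>I\<close>.\<close>
    define k0 where "k0 = max k1 (max n0 (m0 + 2))"
    have "\<forall>k. \<exists>P. k0 \<le> k \<longrightarrow> P \<subseteq> X (N k) \<inter> {a..<a + l / 2} \<and> finite P \<and> c * (l / 2) * (real (N k))\<^sup>2 \<le> card P"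
      using N0 k1 by (metis k0_def max.boundedE)
    then obtain P where P: "\<And>k. k0 \<le> k \<Longrightarrow> P k \<subseteq> X (N k) \<inter> {a..<a + l / 2}"
      "\<And>k. k0 \<le> k \<Longrightarrow> finite (P k)" "\<And>k. k0 \<le> k \<Longrightarrow> c * (l / 2) * (real (N k))\<^sup>2 \<le> card (P k)"
      by metis
    \<comment> \<open>Every scale contributes mass at least \<open>c * l / 8\<close>, so
      \<open>(2 * \<alpha>) ^ m0\<close> scales raise the total to the order of
      \<open>\<alpha> ^ m0\<close>.\<close>
    define n where "n = nat \<lceil>(2 * \<alpha>) ^ m0\<rceil>"
    have ge1: "1 \<le> (2 * \<alpha>) ^ m0" using \<alpha> by (intro one_le_power) auto
    have n: "(2 * \<alpha>) ^ m0 \<le> real n" "real n \<le> 2 * (2 * \<alpha>) ^ m0"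
      unfolding n_def using ge1 by linarith+
    define S where "S = {k0..<k0 + n}"
    have S: "k0 \<le> k" if "k \<in> S" for k using that by (simp add: S_def)
    define G where "G = (\<Union>k\<in>S. successor_cell k ` P k)"
    let ?w = "\<lambda>k r D. \<alpha> ^ k * 2 ^ k * measure lborel (cell (successor_cell k r) \<inter> cell D)"
    have "finite G" using P(2) S by (auto simp: G_def S_def)
    moreover have "n0 \<le> fst J \<and> cell J \<subseteq> cell I \<and> near_cell \<alpha> X J" if J: "J \<in> G" for J
    proof -
      obtain k r where kr: "k \<in> S" "r \<in> P k" "J = successor_cell k r" using J by (auto simp: G_def)
      note k = S[OF kr(1)]
      have r: "r \<in> X (N k)" "a \<le> r" "r < a + l / 2" using P(1)[OF k] kr(2) by auto
      have "(2::real) ^ (m0 + 2) \<le> 2 ^ k" using k by (intro power_increasing) (auto simp: k0_def)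
      then have "2 / 2 ^ k \<le> l / 2" by (simp add: l_def field_simps)
      then have "cell J \<subseteq> cell I"
        using successor_cell_subset[of k r] r unfolding cellI kr(3) by force
      moreover have "near_cell \<alpha> X J"
        unfolding near_cell_def kr(3) using r(1) N(1)[of k] successor_cell_bounds[where k = k and r = r] by auto
      moreover have "n0 \<le> fst J" using k by (simp add: kr(3) successor_cell_bounds(1) k0_def)
      ultimately show ?thesis by blast
    qed
    moreover have "content_ge \<alpha> (c0 * \<alpha> ^ fst I) (\<Union>(cell ` G))"
      unfolding content_ge_def
    proof (intro allI impI)
      fix \<D> assume fin: "finite \<D>" and cov: "\<Union>(cell ` G) \<subseteq> \<Union>(cell ` \<D>)"
      show "c0 * \<alpha> ^ fst I \<le> (\<Sum>D\<in>\<D>. \<alpha> ^ fst D)"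
      proof (cases "\<exists>D\<in>\<D>. fst D < m0")
        case True
        then obtain D where D: "D \<in> \<D>" "fst D < m0" by blast
        have "c0 * \<alpha> ^ m0 \<le> 1 * \<alpha> ^ m0" using \<alpha> by (intro mult_right_mono) (auto simp: c0_def)
        also have "\<dots> \<le> \<alpha> ^ fst D" using \<alpha> D by (simp add: power_decreasing)
        also have "\<dots> \<le> (\<Sum>D\<in>\<D>. \<alpha> ^ fst D)" using D fin \<alpha> by (intro member_le_sum) auto
        finally show ?thesis by (simp add: m0_def)
      next
        case False
        have up: "(\<Sum>k\<in>S. \<Sum>r\<in>P k. ?w k r D) \<le> C * \<alpha> ^ fst D" if D: "D \<in> \<D>" for D
        proof -
          have "(\<Sum>k\<in>S. \<Sum>r\<in>P k. ?w k r D) \<le> (\<Sum>k\<in>S. K\<^sup>2 * (if fst D \<le> k then 1 / 2 ^ fst D + 3 * \<alpha> ^ k else 4 * (2 * \<alpha>) ^ k / 2 ^ fst D))"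
          proof (intro sum_mono one_scale_mass_le[OF \<alpha> K])
            fix k assume "k \<in> S"
            note k = S[OF this]
            show "N k \<ge> 1" "(real (N k))\<^sup>2 * \<alpha> ^ k \<le> 1" "finite (P k)" using N P(2)[OF k] by auto
            show "1 / (K * real (N k))\<^sup>2 \<le> \<bar>x - y\<bar>" if "x \<in> P k" "y \<in> P k" "x \<noteq> y" for x y
              using sep[of x "N k" y] that P(1)[OF k] by auto
          qed
          also have "\<dots> = K\<^sup>2 * (\<Sum>k\<in>S. if fst D \<le> k then 1 / 2 ^ fst D + 3 * \<alpha> ^ k else 4 * (2 * \<alpha>) ^ k / 2 ^ fst D)"
            by (simp only: sum_distrib_left)
          also have "\<dots> \<le> K\<^sup>2 * ((2 + 3 / (1 - \<alpha>) + 4 / (2 * \<alpha> - 1)) * \<alpha> ^ fst D)"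
            unfolding S_def using False D by (intro mult_left_mono sum_one_scale_bounds[OF \<alpha> n(2)]) auto
          finally show ?thesis by (simp add: C_def mult.assoc)
        qed
        have low: "\<alpha> ^ k \<le> (\<Sum>D\<in>\<D>. ?w k r D)" if "k \<in> S" "r \<in> P k" for k r
        proof -
          let ?J = "cell (successor_cell k r)"
          have "?J \<subseteq> \<Union>(cell ` \<D>)" using that cov by (auto simp: G_def)
          then have "?J = (\<Union>D\<in>\<D>. ?J \<inter> cell D)" by blast
          then have "measure lborel ?J \<le> (\<Sum>D\<in>\<D>. measure lborel (?J \<inter> cell D))"
            using measure_UNION_le[OF fin, of "\<lambda>D. ?J \<inter> cell D" lborel] by auto
          then have "\<alpha> ^ k * 2 ^ k * measure lborel ?J \<le> \<alpha> ^ k * 2 ^ k * (\<Sum>D\<in>\<D>. measure lborel (?J \<inter> cell D))"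
            using \<alpha> by (intro mult_left_mono) auto
          then show ?thesis
            by (simp add: measure_cell successor_cell_bounds(1) sum_distrib_left)
        qed
        have "c * \<alpha> ^ m0 / 8 = (2 * \<alpha>) ^ m0 * (c * l / 8)"
          by (simp add: l_def power_mult_distrib)
        also have "\<dots> \<le> real n * (c * l / 8)"
          using n(1) c l by (intro mult_right_mono) auto
        also have "\<dots> = (\<Sum>k\<in>S. c * (l / 2) * (1 / 4))" by (simp add: S_def)
        also have "\<dots> \<le> (\<Sum>k\<in>S. \<Sum>r\<in>P k. \<alpha> ^ k)"
        proof (rule sum_mono)
          fix k assume "k \<in> S"
          note k = S[OF this]
          have "c * (l / 2) * (1 / 4) \<le> c * (l / 2) * ((real (N k))\<^sup>2 * \<alpha> ^ k)"
            using N(2)[of k] c l by (intro mult_left_mono) auto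
          also have "\<dots> = c * (l / 2) * (real (N k))\<^sup>2 * \<alpha> ^ k" by simp
          also have "\<dots> \<le> real (card (P k)) * \<alpha> ^ k"
            using P(3)[OF k] \<alpha> by (intro mult_right_mono) auto
          finally show "c * (l / 2) * (1 / 4) \<le> (\<Sum>r\<in>P k. \<alpha> ^ k)" by simp
        qed
        also have "\<dots> \<le> (\<Sum>k\<in>S. \<Sum>r\<in>P k. \<Sum>D\<in>\<D>. ?w k r D)"
          by (intro sum_mono low)
        also have "\<dots> = (\<Sum>k\<in>S. \<Sum>D\<in>\<D>. \<Sum>r\<in>P k. ?w k r D)"
          by (intro sum.cong refl sum.swap)
        also have "\<dots> = (\<Sum>D\<in>\<D>. \<Sum>k\<in>S. \<Sum>r\<in>P k. ?w k r D)"
          by (rule sum.swap)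
        also have "\<dots> \<le> (\<Sum>D\<in>\<D>. C * \<alpha> ^ fst D)" by (intro sum_mono up)
        also have "\<dots> = C * (\<Sum>D\<in>\<D>. \<alpha> ^ fst D)" by (simp only: sum_distrib_left)
        finally have "c / (8 * C) * \<alpha> ^ m0 \<le> (\<Sum>D\<in>\<D>. \<alpha> ^ fst D)"
          using C by (simp add: field_simps)
        moreover have "c0 * \<alpha> ^ m0 \<le> c / (8 * C) * \<alpha> ^ m0"
          using \<alpha> by (intro mult_right_mono) (auto simp: c0_def)
        ultimately show ?thesis by (simp add: m0_def)
      qed
    qed
    ultimately show ?thesis by blast
  qed
  then show ?thesis using c0 unfolding fills_def by blast
qed

section \<open>Raising the captured fraction to one\<close>

text \<open>Unless the cover has a cell of generation at most \<open>k\<close>, each of its cells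
  that meets a child lies inside that child; the parts covering \<open>A\<close> and
  \<open>B\<close> are then disjoint and each weighs at least \<open>w\<close>.\<close>

lemma content_ge_union_children:
  assumes \<alpha>: "0 < \<alpha>" "\<alpha> < 1"
    and sub: "A \<subseteq> cell (Suc k, 2 * i)" "B \<subseteq> cell (Suc k, 2 * i + 1)" 
    and A: "content_ge \<alpha> w A" and B: "content_ge \<alpha> w B"
  shows "content_ge \<alpha> (min (\<alpha> ^ k) (2 * w)) (A \<union> B)"
  unfolding content_ge_def
proof (intro allI impI)
  fix \<D> assume fin: "finite \<D>" and cov: "A \<union> B \<subseteq> \<Union>(cell ` \<D>)"
  let ?L = "cell (Suc k, 2 * i)" and ?R = "cell (Suc k, 2 * i + 1)"
  show "min (\<alpha> ^ k) (2 * w) \<le> (\<Sum>D\<in>\<D>. \<alpha> ^ fst D)"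
  proof (cases "\<exists>D\<in>\<D>. fst D \<le> k")
    case True
    then obtain D where D: "D \<in> \<D>" "fst D \<le> k" by blast
    have "\<alpha> ^ k \<le> \<alpha> ^ fst D" using \<alpha> D by (simp add: power_decreasing)
    also have "\<dots> \<le> (\<Sum>D\<in>\<D>. \<alpha> ^ fst D)" using D fin \<alpha> by (intro member_le_sum) auto
    finally show ?thesis by simp
  next
    case False
    define DL where "DL = {D \<in> \<D>. cell D \<subseteq> ?L}"
    define DR where "DR = {D \<in> \<D>. cell D \<subseteq> ?R}"
    have nested: "cell D \<subseteq> cell E" if "D \<in> \<D>" "x \<in> cell D" "x \<in> cell E" "fst E = Suc k" for D E x
      using cell_nested[of E D] that False by (metis IntI empty_iff not_less_eq_eq)
    have "A \<subseteq> \<Union>(cell ` DL)"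
    proof
      fix x assume "x \<in> A"
      then obtain D where D: "D \<in> \<D>" "x \<in> cell D" "x \<in> ?L" using cov sub by blast
      from D have "D \<in> DL" using nested[of D x "(Suc k, 2 * i)"] by (simp add: DL_def)
      then show "x \<in> \<Union>(cell ` DL)" using D by blast
    qed
    moreover have "B \<subseteq> \<Union>(cell ` DR)"
    proof
      fix x assume "x \<in> B"
      then obtain D where D: "D \<in> \<D>" "x \<in> cell D" "x \<in> ?R" using cov sub by blast
      from D have "D \<in> DR" using nested[of D x "(Suc k, 2 * i + 1)"] by (simp add: DR_def)
      then show "x \<in> \<Union>(cell ` DR)" using D by blast
    qed
    ultimately have "w \<le> (\<Sum>D\<in>DL. \<alpha> ^ fst D)" "w \<le> (\<Sum>D\<in>DR. \<alpha> ^ fst D)"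
      using content_geD[OF A] content_geD[OF B] fin by (auto simp: DL_def DR_def)
    moreover have "(\<Sum>D\<in>DL. \<alpha> ^ fst D) + (\<Sum>D\<in>DR. \<alpha> ^ fst D) = (\<Sum>D\<in>DL \<union> DR. \<alpha> ^ fst D)"
    proof (rule sum.union_disjoint[symmetric])
      show "DL \<inter> DR = {}"
      proof safe
        fix p q assume "(p, q) \<in> DL" "(p, q) \<in> DR"
        then have "cell (p, q) \<subseteq> ?L \<inter> ?R" by (auto simp: DL_def DR_def)
        then show "(p, q) \<in> {}" using cell_nonempty cell_children_disjoint by blast
      qed
    qed (use fin in \<open>auto simp: DL_def DR_def\<close>)
    moreover have "(\<Sum>D\<in>DL \<union> DR. \<alpha> ^ fst D) \<le> (\<Sum>D\<in>\<D>. \<alpha> ^ fst D)"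
      using fin \<alpha> by (intro sum_mono2) (auto simp: DL_def DR_def)
    ultimately show ?thesis by simp
  qed
qed

lemma fills_double:
  assumes \<alpha>: "0 < \<alpha>" "\<alpha> < 1" and fills: "fills \<alpha> X c"
  shows "fills \<alpha> X (min 1 (2 * \<alpha> * c))"
  unfolding fills_def
proof (intro allI)
  fix I :: "nat \<times> int" and n
  obtain k i where I: "I = (k, i)" by fastforce
  obtain G where G: "finite G" "\<forall>J\<in>G. n \<le> fst J \<and> cell J \<subseteq> cell (Suc k, 2 * i) \<and> near_cell \<alpha> X J"
     "content_ge \<alpha> (c * \<alpha> ^ Suc k) (\<Union>(cell ` G))"
    using fills unfolding fills_def by (metis fst_conv)
  obtain H where H: "finite H" "\<forall>J\<in>H. n \<le> fst J \<and> cell J \<subseteq> cell (Suc k, 2 * i + 1) \<and> near_cell \<alpha> X J"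
     "content_ge \<alpha> (c * \<alpha> ^ Suc k) (\<Union>(cell ` H))"
    using fills unfolding fills_def by (metis fst_conv)
  have "content_ge \<alpha> (min (\<alpha> ^ k) (2 * (c * \<alpha> ^ Suc k))) (\<Union>(cell ` G) \<union> \<Union>(cell ` H))"
    using G H by (intro content_ge_union_children[where i = i] \<alpha>) auto
  moreover have "min (\<alpha> ^ k) (2 * (c * \<alpha> ^ Suc k)) = min 1 (2 * \<alpha> * c) * \<alpha> ^ k"
    using \<alpha> by (subst min_mult_distrib_right) (simp add: mult_ac)
  ultimately have "content_ge \<alpha> (min 1 (2 * \<alpha> * c) * \<alpha> ^ fst I) (\<Union>(cell ` (G \<union> H)))"
    by (simp add: I)
  moreover have "cell J \<subseteq> cell I" if "J \<in> G \<union> H" for J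
    using that G(2) H(2) unfolding I cell_children[of k i] by auto
  ultimately show "\<exists>G. finite G \<and> (\<forall>J\<in>G. n \<le> fst J \<and> cell J \<subseteq> cell I \<and> near_cell \<alpha> X J)
     \<and> content_ge \<alpha> (min 1 (2 * \<alpha> * c) * \<alpha> ^ fst I) (\<Union>(cell ` G))"
    using G(1,2) H(1,2) by (intro exI[of _ "G \<union> H"]) auto
qed

lemma fills_mono:
  assumes "0 < \<alpha>" "fills \<alpha> X c" "d \<le> c"
  shows "fills \<alpha> X d"
proof -
  have "d * \<alpha> ^ k \<le> c * \<alpha> ^ k" for k using assms by (intro mult_right_mono) auto
  then have "content_ge \<alpha> (c * \<alpha> ^ k) E \<Longrightarrow> content_ge \<alpha> (d * \<alpha> ^ k) E" for k E
    unfolding content_ge_def by (meson order_trans)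
  then show ?thesis using assms(2) unfolding fills_def by meson
qed

lemma fills_one:
  assumes \<alpha>: "1 / 2 < \<alpha>" "\<alpha> < 1" and "c > 0" "fills \<alpha> X c"
  shows "fills \<alpha> X 1"
proof -
  have a0: "0 < \<alpha>" using \<alpha> by simp
  have iter: "fills \<alpha> X (min 1 ((2 * \<alpha>) ^ j * c))" for j
  proof (induction j)
    case 0
    then show ?case using fills_mono[OF a0 assms(4)] by simp
  next
    case (Suc j)
    have "fills \<alpha> X (min 1 (2 * \<alpha> * min 1 ((2 * \<alpha>) ^ j * c)))"
      by (rule fills_double[OF a0 \<alpha>(2) Suc])
    \<comment> \<open>The inner cap at 1 disappears in the outer one because
      \<open>2 * \<alpha> \<ge> 1\<close>.\<close>
    moreover have "min 1 (2 * \<alpha> * min 1 ((2 * \<alpha>) ^ j * c)) = min 1 ((2 * \<alpha>) ^ Suc j * c)"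
      using \<alpha> by (simp add: min_mult_distrib_left mult_ac)
    ultimately show ?case by simp
  qed
  obtain j where "1 / c < (2 * \<alpha>) ^ j" using real_arch_pow[of "2 * \<alpha>" "1 / c"] \<alpha> by auto
  then have "1 \<le> (2 * \<alpha>) ^ j * c" using assms(3) by (simp add: field_simps)
  then show ?thesis using iter[of j] by simp
qed

text \<open>An exchange argument. If \<open>\<D>\<close> does not already cover \<open>I\<close>, no
  cell of \<open>\<D>\<close> contains \<open>I\<close>, so the cells of \<open>\<D>\<close> meeting
  \<open>I\<close> lie inside it; they cover \<open>G I\<close>, weigh at least as much as
  \<open>I\<close>, and are exchanged for \<open>I\<close>. The set \<open>H\<close> carries
  everything that later exchanges must keep covered, including the cells restored so far.\<close>

lemma cover_replace:
  assumes \<alpha>: "0 < \<alpha>" and fin: "finite F"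
    and G: "\<And>I. I \<in> F \<Longrightarrow> G I \<subseteq> cell I" "\<And>I. I \<in> F \<Longrightarrow> content_ge \<alpha> (\<alpha> ^ fst I) (G I)"
    and cov: "finite \<D>" "(\<Union>I\<in>F. G I) \<union> H \<subseteq> \<Union>(cell ` \<D>)"
  shows "\<exists>\<D>'. finite \<D>' \<and> (\<Union>I\<in>F. cell I) \<union> H \<subseteq> \<Union>(cell ` \<D>') \<and> (\<Sum>D\<in>\<D>'. \<alpha> ^ fst D) \<le> (\<Sum>D\<in>\<D>. \<alpha> ^ fst D)"
  using fin G cov
proof (induction F arbitrary: \<D> H rule: finite_induct)
  case empty
  then show ?case by auto
next
  case (insert I F)
  obtain \<E> where E: "finite \<E>" "(\<Union>J\<in>F. G J) \<union> (H \<union> cell I) \<subseteq> \<Union>(cell ` \<E>)"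
    "(\<Sum>D\<in>\<E>. \<alpha> ^ fst D) \<le> (\<Sum>D\<in>\<D>. \<alpha> ^ fst D)"
  proof (cases "cell I \<subseteq> \<Union>(cell ` \<D>)")
    case True
    then show ?thesis using insert.prems by (intro that[of \<D>]) auto
  next
    case False
    define DI where "DI = {D \<in> \<D>. cell D \<subseteq> cell I}"
    have sub: "D \<in> DI" if "D \<in> \<D>" "cell D \<inter> cell I \<noteq> {}" for D
    proof (cases "fst D \<le> fst I")
      case True
      then have "cell I \<subseteq> cell D" using cell_nested[of D I] that(2) by auto
      then show ?thesis using False that(1) by blast
    next
      case nle: False
      then have "cell D \<subseteq> cell I" using cell_nested[of I D] that(2) by auto
      then show ?thesis using that(1) by (simp add: DI_def)
    qed
    have finI: "finite DI" using insert.prems by (simp add: DI_def)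
    have "G I \<subseteq> \<Union>(cell ` DI)"
    proof
      fix x assume x: "x \<in> G I"
      then obtain D where "D \<in> \<D>" "x \<in> cell D" using insert.prems(4) by blast
      then show "x \<in> \<Union>(cell ` DI)" using sub[of D] insert.prems(1)[of I] x by blast
    qed
    then have w: "\<alpha> ^ fst I \<le> (\<Sum>D\<in>DI. \<alpha> ^ fst D)"
      using content_geD[OF insert.prems(2)[of I] finI] by simp
    show ?thesis
    proof (rule that[of "insert I (\<D> - DI)"])
      show "finite (insert I (\<D> - DI))" using insert.prems by simp
      have 1: "\<Union>(cell ` \<D>) \<subseteq> \<Union>(cell ` insert I (\<D> - DI))"
        by (auto simp: DI_def)
      have 2: "(\<Union>J\<in>F. G J) \<union> H \<subseteq> \<Union>(cell ` \<D>)"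
        using insert.prems(4) by auto
      have 3: "cell I \<subseteq> \<Union>(cell ` insert I (\<D> - DI))" by simp
      show "(\<Union>J\<in>F. G J) \<union> (H \<union> cell I) \<subseteq> \<Union>(cell ` insert I (\<D> - DI))"
        unfolding Un_assoc[symmetric] by (rule Un_least[OF order_trans[OF 2 1] 3])
      have "(\<Sum>D\<in>insert I (\<D> - DI). \<alpha> ^ fst D) \<le> \<alpha> ^ fst I + (\<Sum>D\<in>\<D> - DI. \<alpha> ^ fst D)"
        using insert.prems \<alpha> by (simp add: sum.insert_if)
      also have "\<dots> \<le> (\<Sum>D\<in>DI. \<alpha> ^ fst D) + (\<Sum>D\<in>\<D> - DI. \<alpha> ^ fst D)" using w by simp
      also have "\<dots> = (\<Sum>D\<in>\<D>. \<alpha> ^ fst D)"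
        using insert.prems sum.subset_diff[of DI \<D> "\<lambda>D. \<alpha> ^ fst D"] by (auto simp: DI_def)
      finally show "(\<Sum>D\<in>insert I (\<D> - DI). \<alpha> ^ fst D) \<le> (\<Sum>D\<in>\<D>. \<alpha> ^ fst D)" .
    qed
  qed
  obtain \<D>' where D': "finite \<D>'" "(\<Union>J\<in>F. cell J) \<union> (H \<union> cell I) \<subseteq> \<Union>(cell ` \<D>')"
     "(\<Sum>D\<in>\<D>'. \<alpha> ^ fst D) \<le> (\<Sum>D\<in>\<E>. \<alpha> ^ fst D)"
    using insert.IH[of \<E> "H \<union> cell I"] insert.prems E(1,2) by auto
  then show ?case using E(3) by (intro exI[of _ \<D>']) auto
qed

text \<open>Lebesgue measure bounds the content from below, since
  \<open>1 / 2 ^ k \<le> \<alpha> ^ k\<close>. This supplies the root of the tree.\<close>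

lemma content_ge_cell_union:
  assumes \<alpha>: "1 / 2 < \<alpha>"
  shows "content_ge \<alpha> (real M) (\<Union>i\<in>{..<M}. cell (0, int i))"
  unfolding content_ge_def
proof (intro allI impI)
  fix \<D> assume fin: "finite \<D>" and cov: "(\<Union>i\<in>{..<M}. cell (0, int i)) \<subseteq> \<Union>(cell ` \<D>)"
  have "{0..<real M} \<subseteq> (\<Union>i\<in>{..<M}. cell (0, int i))"
  proof
    fix x assume x: "x \<in> {0..<real M}"
    have "x \<in> cell (0, int (nat \<lfloor>x\<rfloor>))" using x by (simp add: mem_cell_iff)
    moreover have "nat \<lfloor>x\<rfloor> < M" using x by (simp add: nat_less_iff floor_less_iff)
    ultimately show "x \<in> (\<Union>i\<in>{..<M}. cell (0, int i))" by blast
  qed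
  then have sub: "{0..<real M} \<subseteq> \<Union>(cell ` \<D>)" using cov by blast
  have "real M = measure lborel {0..<real M}" by simp
  also have "\<dots> \<le> measure lborel (\<Union>(cell ` \<D>))"
    using fin by (intro measure_mono_fmeasurable sub) (auto intro!: fmeasurable_cell)
  also have "\<dots> \<le> (\<Sum>D\<in>\<D>. measure lborel (cell D))"
    using fin by (intro measure_UNION_le sets_cell)
  also have "\<dots> \<le> (\<Sum>D\<in>\<D>. \<alpha> ^ fst D)"
  proof (rule sum_mono)
    fix D :: "nat \<times> int"
    have "(1 / 2) ^ fst D \<le> \<alpha> ^ fst D" using \<alpha> by (intro power_mono) auto
    then show "measure lborel (cell D) \<le> \<alpha> ^ fst D" by (simp add: measure_cell power_one_over)
  qed
  finally show "real M \<le> (\<Sum>D\<in>\<D>. \<alpha> ^ fst D)" .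
qed

section \<open>Infinite Hausdorff measure\<close>

text \<open>Closed cells have compact finite unions. The closure does not spoil the approximation,
  because the point \<open>r\<close> in \<open>near_cell\<close> is strictly left of the closed cell
  as well.\<close>

definition ccell :: "nat \<times> int \<Rightarrow> real set" where
  "ccell D = {of_int (snd D) / 2 ^ fst D .. (of_int (snd D) + 1) / 2 ^ fst D}"

lemma ccell_closure: "ccell D = closure (cell D)"
  by (simp add: ccell_def cell_def divide_strict_right_mono)

lemma cell_subset_ccell: "cell D \<subseteq> ccell D"
  by (auto simp: cell_def ccell_def)

definition limsup_cells :: "real \<Rightarrow> (nat \<Rightarrow> real set) \<Rightarrow> real set" where
  "limsup_cells \<alpha> X = {x. \<forall>n. \<exists>J. n \<le> fst J \<and> near_cell \<alpha> X J \<and> x \<in> ccell J}"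

text \<open>Each cell is replaced by a filling of full content. By \<open>cover_replace\<close> a
  cover of one generation yields a cover of the previous one of no larger weight, so the content
  \<open>M\<close> of the root survives in all generations.\<close>

lemma fills_tree:
  assumes \<alpha>: "1 / 2 < \<alpha>" and "fills \<alpha> X 1"
  obtains F :: "nat \<Rightarrow> (nat \<times> int) set" where
    "\<And>n. finite (F n)" "\<And>n J. J \<in> F (Suc n) \<Longrightarrow> n \<le> fst J \<and> near_cell \<alpha> X J \<and> (\<exists>I\<in>F n. cell J \<subseteq> cell I)"
    "\<And>n. content_ge \<alpha> (real M) (\<Union>(cell ` F n))"
proof -
  have a0: "0 < \<alpha>" using \<alpha> by simp
  have "\<forall>I n. \<exists>G. finite G \<and> (\<forall>J\<in>G. n \<le> fst J \<and> cell J \<subseteq> cell I \<and> near_cell \<alpha> X J)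
     \<and> content_ge \<alpha> (\<alpha> ^ fst I) (\<Union>(cell ` G))"
    using assms(2) by (simp add: fills_def)
  then obtain G where G: "\<And>I n. finite (G I n)"
    "\<And>I n J. J \<in> G I n \<Longrightarrow> n \<le> fst J \<and> cell J \<subseteq> cell I \<and> near_cell \<alpha> X J"
    "\<And>I n. content_ge \<alpha> (\<alpha> ^ fst I) (\<Union>(cell ` G I n))"
    by metis
  define F where "F = rec_nat ((\<lambda>i. (0, int i)) ` {..<M}) (\<lambda>n S. \<Union>I\<in>S. G I n)"
  have F0: "F 0 = (\<lambda>i. (0, int i)) ` {..<M}" and FS: "F (Suc n) = (\<Union>I\<in>F n. G I n)" for n
    by (simp_all add: F_def)
  show thesis
  proof
    show fin: "finite (F n)" for n
      by (induction n) (simp_all add: F0 FS G(1))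
    show "n \<le> fst J \<and> near_cell \<alpha> X J \<and> (\<exists>I\<in>F n. cell J \<subseteq> cell I)" if J: "J \<in> F (Suc n)" for n J
    proof -
      obtain I where "I \<in> F n" "J \<in> G I n" using J unfolding FS by blast
      then show ?thesis using G(2) by blast
    qed
    show "content_ge \<alpha> (real M) (\<Union>(cell ` F n))" for n
    proof (induction n)
      case 0
      then show ?case using content_ge_cell_union[OF \<alpha>, of M] by (simp add: F0 image_image)
    next
      case (Suc n)
      show ?case unfolding content_ge_def
      proof (intro allI impI)
        fix \<D> assume D: "finite \<D>" "\<Union>(cell ` F (Suc n)) \<subseteq> \<Union>(cell ` \<D>)"
        have "\<exists>\<D>'. finite \<D>' \<and> (\<Union>I\<in>F n. cell I) \<union> {} \<subseteq> \<Union>(cell ` \<D>') \<and> (\<Sum>D\<in>\<D>'. \<alpha> ^ fst D) \<le> (\<Sum>D\<in>\<D>. \<alpha> ^ fst D)"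
        proof (rule cover_replace[OF a0 fin, where G = "\<lambda>I. \<Union>(cell ` G I n)"])
          show "\<Union>(cell ` G I n) \<subseteq> cell I" for I using G(2) by blast
          show "(\<Union>I\<in>F n. \<Union>(cell ` G I n)) \<union> {} \<subseteq> \<Union>(cell ` \<D>)"
            using D(2) by (simp add: FS)
        qed (use G(3) D(1) in auto)
        then obtain \<D>' where D': "finite \<D>'" "\<Union>(cell ` F n) \<subseteq> \<Union>(cell ` \<D>')"
          "(\<Sum>D\<in>\<D>'. \<alpha> ^ fst D) \<le> (\<Sum>D\<in>\<D>. \<alpha> ^ fst D)" by auto
        show "real M \<le> (\<Sum>D\<in>\<D>. \<alpha> ^ fst D)"
          using content_geD[OF Suc D'(1,2)] D'(3) by linarith
      qed
    qed
  qed
qed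

section \<open>From arbitrary covers to finite dyadic covers\<close>

lemma powr_minus_power:
  fixes s :: real
  shows "(2 powr - s) ^ k = ((1 / 2) ^ k) powr s"
proof -
  have "(2 powr - s) ^ k = 2 powr (- s * real k)" by (simp add: powr_powr flip: powr_realpow)
  also have "\<dots> = (2 powr - real k) powr s" by (simp add: powr_powr mult.commute)
  also have "2 powr - real k = (1 / 2) ^ k" by (simp add: powr_minus powr_realpow power_one_over inverse_eq_divide)
  finally show ?thesis .
qed

text \<open>Three consecutive cells of length between \<open>e\<close> and \<open>2 * e\<close>
  suffice, and \<open>3 * (2 * e) powr s \<le> 6 * e powr s\<close>. The bound
  \<open>e \<le> 1\<close> ensures that their generation is a natural number.\<close>

lemma ball_cover_cells:
  assumes s: "0 < s" "s \<le> 1" and e: "0 < e" "e \<le> 1"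
  shows "\<exists>C. finite C \<and> ball x e \<subseteq> \<Union>(cell ` C) \<and> (\<Sum>D\<in>C. (2 powr - s) ^ fst D) \<le> 6 * e powr s"
proof -
  define k' where "k' = (LEAST k. (1 / 2 :: real) ^ k < e)"
  obtain k0 where "(1 / 2 :: real) ^ k0 < e" using real_arch_pow_inv[OF e(1), of "1 / 2"] by auto
  then have k': "(1 / 2 :: real) ^ k' < e" unfolding k'_def by (rule LeastI)
  have "k' \<noteq> 0" using k' e(2) by (intro notI) simp
  then obtain k where k: "k' = Suc k" by (cases k') auto
  have "\<not> (1 / 2 :: real) ^ k < e" using not_less_Least[of k "\<lambda>k. (1 / 2 :: real) ^ k < e"] k
    unfolding k'_def by simp
  then have ek: "e \<le> (1 / 2) ^ k" by simp
  have ke: "(1 / 2) ^ k \<le> 2 * e" using k' by (simp add: k)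
  define j where "j = \<lfloor>x * 2 ^ k\<rfloor>"
  let ?C = "{(k, j - 1), (k, j), (k, j + 1)}"
  have "ball x e \<subseteq> \<Union>(cell ` ?C)"
  proof
    fix y assume "y \<in> ball x e"
    then have "\<bar>y - x\<bar> < (1 / 2) ^ k" using ek by (simp add: dist_real_def abs_minus_commute)
    then have "\<bar>y - x\<bar> * 2 ^ k < 1" by (simp add: power_one_over field_simps)
    then have "\<bar>y * 2 ^ k - x * 2 ^ k\<bar> < 1" by (simp add: abs_mult flip: left_diff_distrib)
    then have "\<lfloor>y * 2 ^ k\<rfloor> \<in> {j - 1, j, j + 1}" unfolding j_def by (simp; linarith)
    then show "y \<in> \<Union>(cell ` ?C)" by (auto simp: mem_cell_iff)
  qed
  moreover have "(\<Sum>D\<in>?C. (2 powr - s) ^ fst D) \<le> 6 * e powr s"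
  proof -
    have "(2 powr - s) ^ k \<le> (2 * e) powr s"
      unfolding powr_minus_power using ke s by (intro powr_mono2) auto
    also have "\<dots> = 2 powr s * e powr s" using e by (simp add: powr_mult)
    also have "\<dots> \<le> 2 * e powr s"
      using powr_mono[of s 1 2] s by (intro mult_right_mono) auto
    finally show ?thesis by simp
  qed
  ultimately show ?thesis by (intro exI[of _ ?C]) simp
qed

text \<open>Cantor's intersection theorem for the uncovered parts: they are compact, nested and have
  empty intersection, so one of them is empty, and that \<open>E n\<close> has a finite
  subcover.\<close>

lemma compact_nested_open_cover:
  fixes E :: "nat \<Rightarrow> real set" and V :: "nat \<Rightarrow> real set"
  assumes "\<And>n. compact (E n)" "\<And>n. E (Suc n) \<subseteq> E n" "\<And>i. open (V i)" "\<Inter>(range E) \<subseteq> \<Union>(range V)"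
  shows "\<exists>n T. finite T \<and> E n \<subseteq> (\<Union>i\<in>T. V i)"
proof -
  have op: "open (\<Union>(range V))" using assms(3) by auto
  have mono: "E n \<subseteq> E m" if "m \<le> n" for m n
    by (rule lift_Suc_antimono_le[of E, OF assms(2) that])
  have "\<exists>n. E n - \<Union>(range V) = {}"
  proof (rule ccontr)
    assume "\<nexists>n. E n - \<Union>(range V) = {}"
    then have ne: "E n - \<Union>(range V) \<noteq> {}" for n by blast
    have "\<Inter>(range (\<lambda>n. E n - \<Union>(range V))) \<noteq> {}"
    proof (rule compact_nest)
      show "compact (E n - \<Union>(range V))" for n by (intro compact_diff assms(1) op)
      show "E n - \<Union>(range V) \<subseteq> E m - \<Union>(range V)" if "m \<le> n" for m n
        using mono[OF that] by blast
    qed (rule ne)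
    then show False using assms(4) by blast
  qed
  then obtain n where n: "E n \<subseteq> \<Union>(range V)" by blast
  have "\<exists>T. T \<subseteq> UNIV \<and> finite T \<and> E n \<subseteq> (\<Union>i\<in>T. V i)"
    using compactE_image[OF assms(1)[of n], of UNIV V] assms(3) n by metis
  then show ?thesis by blast
qed

lemma diam_pow_nonneg: "diam_pow s U \<ge> 0"
  by (simp add: diam_pow_def)

lemma hausdorff_pre_geI:
  assumes "\<And>U. A \<subseteq> (\<Union>i. U i) \<Longrightarrow> (\<And>i::nat. bounded (U i)) \<Longrightarrow> (\<And>i. diameter (U i) \<le> \<delta>) \<Longrightarrow> w \<le> (\<Sum>i. ennreal (diam_pow s (U i)))"
  shows "w \<le> hausdorff_pre s \<delta> A"
  unfolding hausdorff_pre_def using assms by (intro INF_greatest) auto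

lemma hausdorff_pre_le_measure: "\<delta> > 0 \<Longrightarrow> hausdorff_pre s \<delta> A \<le> hausdorff_measure s A"
  unfolding hausdorff_measure_def by (intro SUP_upper) simp

lemma hausdorff_pre_mono: "A \<subseteq> B \<Longrightarrow> hausdorff_pre s \<delta> A \<le> hausdorff_pre s \<delta> B"
  unfolding hausdorff_pre_def by (intro INF_superset_mono) auto

lemma hausdorff_measure_mono: "A \<subseteq> B \<Longrightarrow> hausdorff_measure s A \<le> hausdorff_measure s B"
  unfolding hausdorff_measure_def by (intro SUP_mono') (rule hausdorff_pre_mono)

lemma sum_UN_le:
  fixes f :: "'a \<Rightarrow> real"
  assumes "finite T" "\<And>i. i \<in> T \<Longrightarrow> finite (C i)" "\<And>x. 0 \<le> f x"
  shows "sum f (\<Union>i\<in>T. C i) \<le> (\<Sum>i\<in>T. sum f (C i))"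
  using assms(1,2)
proof (induction T rule: finite_induct)
  case (insert i T)
  have "sum f (C i \<union> (\<Union>i\<in>T. C i)) + sum f (C i \<inter> (\<Union>i\<in>T. C i)) = sum f (C i) + sum f (\<Union>i\<in>T. C i)"
    using insert by (intro sum.union_inter) auto
  moreover have "0 \<le> sum f (C i \<inter> (\<Union>i\<in>T. C i))" by (intro sum_nonneg assms(3))
  ultimately show ?case using insert by simp
qed simp

text \<open>A cheap cover of the limsup set, enlarged to open balls, would by compactness contain a
  finite cover of one generation, whose content is at least \<open>M\<close>. With three cells per
  ball its weight stays below \<open>M / 4 + 1 / 4\<close>.\<close>

lemma cover_limsup_cells:
  fixes s :: real
  assumes s: "0 < s" "s < 1" and fills: "fills (2 powr - s) X 1" and M: "M \<ge> 1"
    and U: "limsup_cells (2 powr - s) X \<subseteq> (\<Union>i. U i)" "\<And>i::nat. bounded (U i)" "\<And>i. diameter (U i) \<le> 1 / 2"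
  shows "ennreal (real M / 24) \<le> (\<Sum>i. ennreal (diam_pow s (U i)))"
proof (rule ccontr)
  assume neg: "\<not> ?thesis"
  define \<alpha> where "\<alpha> = 2 powr - s"
  have "2 powr -1 < 2 powr - s" "2 powr - s < 2 powr 0" using s by (intro powr_less_mono; simp)+
  then have \<alpha>: "1 / 2 < \<alpha>" "\<alpha> < 1" by (simp_all add: \<alpha>_def powr_minus)
  obtain F where F: "\<And>n. finite (F n)"
    "\<And>n J. J \<in> F (Suc n) \<Longrightarrow> n \<le> fst J \<and> near_cell \<alpha> X J \<and> (\<exists>I\<in>F n. cell J \<subseteq> cell I)"
    "\<And>n. content_ge \<alpha> (real M) (\<Union>(cell ` F n))"
    using fills_tree[OF \<alpha>(1), of X M] fills unfolding \<alpha>_def by metis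
  define E where "E n = \<Union>(ccell ` F n)" for n
  have comp: "compact (E n)" for n
    using F(1) by (auto simp: E_def ccell_def)
  have dec: "E (Suc n) \<subseteq> E n" for n
  proof
    fix x assume "x \<in> E (Suc n)"
    then obtain J where J: "J \<in> F (Suc n)" "x \<in> ccell J" by (auto simp: E_def)
    then obtain I where "I \<in> F n" "cell J \<subseteq> cell I" using F(2) by blast
    moreover from this have "ccell J \<subseteq> ccell I" by (simp add: ccell_closure closure_mono)
    ultimately show "x \<in> E n" using J(2) unfolding E_def by blast
  qed
  have EL: "\<Inter>(range E) \<subseteq> limsup_cells \<alpha> X"
  proof
    fix x assume x: "x \<in> \<Inter>(range E)"
    have "\<exists>J. n \<le> fst J \<and> near_cell \<alpha> X J \<and> x \<in> ccell J" for n
    proof -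
      have "x \<in> E (Suc n)" using x by blast
      then show ?thesis using F(2) unfolding E_def by blast
    qed
    then show "x \<in> limsup_cells \<alpha> X" by (simp add: limsup_cells_def)
  qed
  define d where "d i = diam_pow s (U i)" for i
  \<comment> \<open>The bound 1/24 leaves room in the final estimate; \<open>1 - \<alpha>\<close>
    keeps \<open>d i + \<epsilon> i \<le> 1\<close>, since diameters up to 1/2 give
    \<open>d i \<le> \<alpha>\<close>.\<close>
  define \<eta> where "\<eta> = min (1 / 24) (1 - \<alpha>)"
  have \<eta>: "\<eta> > 0" using \<alpha> by (simp add: \<eta>_def)
  define \<epsilon> where "\<epsilon> i = \<eta> * (1 / 2) ^ Suc i" for i
  have \<epsilon>: "\<epsilon> i > 0" for i using \<eta> by (simp add: \<epsilon>_def)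
  have \<epsilon>_le: "\<epsilon> i \<le> \<eta>" for i using \<eta> power_le_one[of "1 / 2 :: real" "Suc i"]
    unfolding \<epsilon>_def by (intro mult_left_le) auto
  have \<epsilon>_sum: "sum \<epsilon> T \<le> \<eta>" if "finite T" for T
  proof -
    have "\<epsilon> sums (\<eta> * 1)" unfolding \<epsilon>_def by (intro sums_mult power_half_series)
    then show ?thesis using sum_le_suminf[of \<epsilon> T] that \<epsilon> by (simp add: sums_iff less_imp_le)
  qed
  \<comment> \<open>Chosen so that \<open>e i powr s\<close> exceeds \<open>d i\<close> by exactly
    \<open>\<epsilon> i\<close>; the radius is positive even for sets of diameter 0, and strictly
    larger than the diameter of a non-empty \<open>U i\<close>.\<close>
  define e where "e i = (d i + \<epsilon> i) powr (1 / s)" for i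
  have d0: "d i \<ge> 0" for i by (simp add: d_def diam_pow_nonneg)
  have d1: "d i \<le> \<alpha>" for i
  proof -
    have "diameter (U i) powr s \<le> (1 / 2) powr s"
      using U(2,3) s by (intro powr_mono2) (auto intro: diameter_ge_0)
    also have "\<dots> = \<alpha>" using powr_minus_power[of s 1] by (simp add: \<alpha>_def)
    finally show ?thesis using \<alpha> s by (simp add: d_def diam_pow_def)
  qed
  have e0: "e i > 0" for i
  proof -
    have "0 < d i + \<epsilon> i" using d0[of i] \<epsilon>[of i] by linarith
    then show ?thesis by (simp add: e_def)
  qed
  have e1: "e i \<le> 1" for i
  proof -
    have "d i + \<epsilon> i \<le> 1" using d1[of i] \<epsilon>_le[of i] by (simp add: \<eta>_def)
    then have "e i \<le> 1 powr (1 / s)" unfolding e_def using d0[of i] \<epsilon>[of i] s by (intro powr_mono2) auto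
    then show ?thesis by simp
  qed
  have es: "e i powr s = d i + \<epsilon> i" for i
    using d0[of i] \<epsilon>[of i] s by (simp add: e_def powr_powr)
  define c where "c i = (SOME x. x \<in> U i)" for i
  have sub: "U i \<subseteq> ball (c i) (e i)" for i
  proof
    fix x assume x: "x \<in> U i"
    then have "c i \<in> U i" unfolding c_def by (rule someI)
    then have le: "dist (c i) x \<le> diameter (U i)" using U(2) x by (intro diameter_bounded_bound)
    have "diameter (U i) powr s = d i" using x s by (auto simp: d_def diam_pow_def)
    then have "diameter (U i) powr s < e i powr s" using es[of i] \<epsilon>[of i] by simp
    then have "diameter (U i) < e i"
      using powr_mono2[of s "e i" "diameter (U i)"] s e0[of i] by linarith
    then show "x \<in> ball (c i) (e i)" using le by simp
  qed
  have "limsup_cells \<alpha> X \<subseteq> (\<Union>i. U i)" using U(1) by (simp add: \<alpha>_def)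
  also have "\<dots> \<subseteq> (\<Union>i. ball (c i) (e i))" by (intro UN_mono sub) simp
  finally have "\<Inter>(range E) \<subseteq> (\<Union>i. ball (c i) (e i))" using EL by (rule order_trans[rotated])
  then obtain n T where T: "finite T" "E n \<subseteq> (\<Union>i\<in>T. ball (c i) (e i))"
    using compact_nested_open_cover[of E "\<lambda>i. ball (c i) (e i)"] comp dec by auto
  have "\<forall>i. \<exists>C. finite C \<and> ball (c i) (e i) \<subseteq> \<Union>(cell ` C) \<and> (\<Sum>D\<in>C. \<alpha> ^ fst D) \<le> 6 * (d i + \<epsilon> i)"
    using ball_cover_cells[OF s(1) less_imp_le[OF s(2)] e0 e1] unfolding es \<alpha>_def by blast
  then obtain C where C: "\<And>i. finite (C i)" "\<And>i. ball (c i) (e i) \<subseteq> \<Union>(cell ` C i)"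
    "\<And>i. (\<Sum>D\<in>C i. \<alpha> ^ fst D) \<le> 6 * (d i + \<epsilon> i)" by metis
  have "real M \<le> (\<Sum>D\<in>\<Union>(C ` T). \<alpha> ^ fst D)"
  proof (rule content_geD[OF F(3)[of n]])
    show "finite (\<Union>(C ` T))" using T C by auto
    have "\<Union>(cell ` F n) \<subseteq> E n" unfolding E_def using cell_subset_ccell by blast
    also have "\<dots> \<subseteq> \<Union>(cell ` \<Union>(C ` T))" using T(2) C(2) by fastforce
    finally show "\<Union>(cell ` F n) \<subseteq> \<Union>(cell ` \<Union>(C ` T))" .
  qed
  also have "\<dots> \<le> (\<Sum>i\<in>T. \<Sum>D\<in>C i. \<alpha> ^ fst D)"
    using T C(1) \<alpha> by (intro sum_UN_le) auto
  also have "\<dots> \<le> (\<Sum>i\<in>T. 6 * (d i + \<epsilon> i))" by (intro sum_mono C)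
  also have "\<dots> = 6 * (sum d T + sum \<epsilon> T)" by (simp add: sum.distrib sum_distrib_left)
  finally have "real M \<le> 6 * (sum d T + sum \<epsilon> T)" .
  moreover have "sum \<epsilon> T \<le> 1 / 24" using \<epsilon>_sum[OF T(1)] by (simp add: \<eta>_def)
  moreover have "sum d T < real M / 24"
  proof -
    have "ennreal (sum d T) = (\<Sum>i\<in>T. ennreal (d i))" using d0 by (simp add: sum_ennreal)
    also have "\<dots> \<le> (\<Sum>i. ennreal (d i))" by (intro sum_le_suminf T) auto
    also have "\<dots> < ennreal (real M / 24)" using neg by (simp add: d_def not_le)
    finally show ?thesis using d0 by (simp add: ennreal_less_iff sum_nonneg)
  qed
  ultimately show False using M by simp
qed

lemma ennreal_eq_top_if_ge_nat:
  fixes x :: ennreal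
  assumes "c > 0" "\<And>M::nat. M \<ge> 1 \<Longrightarrow> ennreal (real M * c) \<le> x"
  shows "x = \<infinity>"
proof (rule ccontr)
  assume "x \<noteq> \<infinity>"
  then obtain r where r: "x = ennreal r" "r \<ge> 0" by (cases x) auto
  obtain M :: nat where "r / c < real M" using reals_Archimedean2 by blast
  then have M: "r < real (Suc M) * c" using assms(1) by (simp add: field_simps)
  have "ennreal (real (Suc M) * c) \<le> ennreal r" using assms(2)[of "Suc M"] r by simp
  then show False using M r(2) by (simp add: ennreal_le_iff)
qed

lemma hausdorff_measure_limsup_cells:
  assumes s: "0 < s" "s < 1" and fills: "fills (2 powr - s) X 1"
  shows "hausdorff_measure s (limsup_cells (2 powr - s) X) = \<infinity>"
proof (rule ennreal_eq_top_if_ge_nat[of "1 / 24"])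
  fix M :: nat assume "M \<ge> 1"
  then have "ennreal (real M * (1 / 24)) \<le> hausdorff_pre s (1 / 2) (limsup_cells (2 powr - s) X)"
    using cover_limsup_cells[OF s fills \<open>M \<ge> 1\<close>] by (intro hausdorff_pre_geI) simp
  also have "\<dots> \<le> hausdorff_measure s (limsup_cells (2 powr - s) X)"
    by (rule hausdorff_pre_le_measure) simp
  finally show "ennreal (real M * (1 / 24)) \<le> hausdorff_measure s (limsup_cells (2 powr - s) X)" .
qed simp

section \<open>Exponent one, by Lebesgue measure\<close>

text \<open>A set of diameter \<open>d\<close> lies in a closed ball of Lebesgue measure
  \<open>2 * d\<close> around any of its points, so the diameters of a cover sum to at least half
  the length of \<open>{0..M}\<close>.\<close>

lemma hausdorff_measure_one_cocountable:
  assumes "countable (- A)"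
  shows "hausdorff_measure 1 A = \<infinity>"
proof (rule ennreal_eq_top_if_ge_nat[of "1 / 2"])
  fix M :: nat assume "M \<ge> 1"
  have "ennreal (real M * (1 / 2)) \<le> hausdorff_pre 1 1 A"
  proof (rule hausdorff_pre_geI)
    fix U :: "nat \<Rightarrow> real set"
    assume U: "A \<subseteq> (\<Union>i. U i)" "\<And>i. bounded (U i)"
    define c where "c i = (SOME x. x \<in> U i)" for i
    define V where "V i = (if U i = {} then {} else cball (c i) (diameter (U i)))" for i
    have sub: "U i \<subseteq> V i" for i
    proof
      fix x assume x: "x \<in> U i"
      then have "c i \<in> U i" unfolding c_def by (rule someI)
      then have "dist (c i) x \<le> diameter (U i)" using U(2) x by (intro diameter_bounded_bound)
      then show "x \<in> V i" using x by (auto simp: V_def)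
    qed
    have V: "emeasure lborel (V i) = 2 * ennreal (diam_pow 1 (U i))" for i
    proof (cases "U i = {}")
      case False
      have "diameter (U i) \<ge> 0" using U(2) by (rule diameter_ge_0)
      then have "emeasure lborel (cball (c i) (diameter (U i))) = ennreal (2 * diameter (U i))"
        by (simp add: cball_eq_atLeastAtMost)
      then show ?thesis using False \<open>diameter (U i) \<ge> 0\<close>
        by (simp add: V_def diam_pow_def ennreal_mult)
    qed (simp add: V_def diam_pow_def)
    have null: "- A \<in> null_sets lborel" by (rule countable_imp_null_set_lborel[OF assms])
    have "{0..real M} \<subseteq> - A \<union> (\<Union>i. V i)" using U(1) sub by blast
    then have "emeasure lborel {0..real M} \<le> emeasure lborel (- A \<union> (\<Union>i. V i))"
      using null by (intro emeasure_mono) (auto simp: V_def)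
    also have "\<dots> = emeasure lborel (\<Union>i. V i)"
      using null by (subst Un_commute, intro emeasure_Un_null_set) (auto simp: V_def)
    also have "\<dots> \<le> (\<Sum>i. emeasure lborel (V i))"
      by (intro emeasure_subadditive_countably) (auto simp: V_def)
    also have "\<dots> = 2 * (\<Sum>i. ennreal (diam_pow 1 (U i)))"
      unfolding V by (simp add: ennreal_suminf_cmult)
    finally have le: "ennreal (real M) \<le> 2 * (\<Sum>i. ennreal (diam_pow 1 (U i)))" by simp
    have "ennreal (real M) = 2 * ennreal (real M * (1 / 2))"
      by (simp flip: ennreal_numeral ennreal_mult)
    then show "ennreal (real M * (1 / 2)) \<le> (\<Sum>i. ennreal (diam_pow 1 (U i)))"
      using le by (simp add: ennreal_mult_le_mult_iff)
  qed
  also have "\<dots> \<le> hausdorff_measure 1 A" by (rule hausdorff_pre_le_measure) simp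
  finally show "ennreal (real M * (1 / 2)) \<le> hausdorff_measure 1 A" .
qed simp

section \<open>Vanishing Hausdorff measure above the critical exponent\<close>

lemma hausdorff_pre_le:
  assumes "A \<subseteq> (\<Union>i. U i)" "\<And>i::nat. bounded (U i)" "\<And>i. diameter (U i) \<le> \<delta>"
  shows "hausdorff_pre s \<delta> A \<le> (\<Sum>i. ennreal (diam_pow s (U i)))"
  unfolding hausdorff_pre_def using assms by (intro INF_lower) auto

lemma hausdorff_pre_empty [simp]: "\<delta> \<ge> 0 \<Longrightarrow> hausdorff_pre s \<delta> {} = 0"
  using hausdorff_pre_le[of "{}" "\<lambda>_. {}" \<delta> s] by (simp add: diam_pow_def)

lemma hausdorff_pre_cball:
  assumes "0 < s" "0 \<le> r" "2 * r \<le> \<delta>"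
  shows "hausdorff_pre s \<delta> (cball x r) \<le> ennreal ((2 * r) powr s)"
proof -
  let ?U = "\<lambda>i::nat. if i = 0 then cball x r else {}"
  have "hausdorff_pre s \<delta> (cball x r) \<le> (\<Sum>i. ennreal (diam_pow s (?U i)))"
    using assms by (intro hausdorff_pre_le) (auto split: if_splits)
  also have "\<dots> = (\<Sum>i\<in>{0}. ennreal (diam_pow s (?U i)))"
    by (intro suminf_finite) (auto simp: diam_pow_def)
  also have "\<dots> = ennreal ((2 * r) powr s)"
    using assms by (simp add: diam_pow_def)
  finally show ?thesis .
qed

lemma hausdorff_pre_countably_subadditive:
  "hausdorff_pre s \<delta> (\<Union>i::nat. A i) \<le> (\<Sum>i. hausdorff_pre s \<delta> (A i))"
proof (rule ennreal_le_epsilon)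
  fix e :: real
  assume e: "0 < e" and fin: "(\<Sum>i. hausdorff_pre s \<delta> (A i)) < Orderings.top"
  \<comment> \<open>The right-hand side may be taken finite, and then each \<open>A i\<close> has a
    cover within \<open>e / 2 ^ Suc i\<close> of its infimum.\<close>
  have "\<exists>U. A i \<subseteq> (\<Union>j::nat. U j) \<and> (\<forall>j. bounded (U j) \<and> diameter (U j) \<le> \<delta>) \<and>
      (\<Sum>j. ennreal (diam_pow s (U j))) \<le> hausdorff_pre s \<delta> (A i) + ennreal e * ennreal ((1 / 2) ^ Suc i)" for i
  proof -
    define w where "w = hausdorff_pre s \<delta> (A i) + ennreal e * ennreal ((1 / 2) ^ Suc i)"
    have "hausdorff_pre s \<delta> (A i) \<le> (\<Sum>i. hausdorff_pre s \<delta> (A i))"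
      using sum_le_suminf[of "\<lambda>i. hausdorff_pre s \<delta> (A i)" "{i}"] by simp
    then have "hausdorff_pre s \<delta> (A i) \<noteq> \<infinity>" using fin by auto
    moreover have "0 < ennreal e * ennreal ((1 / 2) ^ Suc i)"
      using e by (simp add: ennreal_zero_less_mult_iff)
    ultimately have "hausdorff_pre s \<delta> (A i) < w"
      by (auto simp: w_def less_top)
    then have "\<exists>U\<in>{U. A i \<subseteq> (\<Union>j. U j) \<and> (\<forall>j. bounded (U j) \<and> diameter (U j) \<le> \<delta>)}.
        (\<Sum>j. ennreal (diam_pow s (U j))) < w"
      by (simp only: hausdorff_pre_def INF_less_iff)
    then show ?thesis unfolding w_def by (auto intro: less_imp_le)
  qed
  then obtain U where U: "\<And>i. A i \<subseteq> (\<Union>j::nat. U i j)" "\<And>i j. bounded (U i j)" "\<And>i j. diameter (U i j) \<le> \<delta>"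
    "\<And>i. (\<Sum>j. ennreal (diam_pow s (U i j))) \<le> hausdorff_pre s \<delta> (A i) + ennreal e * ennreal ((1 / 2) ^ Suc i)"
    by metis
  let ?V = "\<lambda>n. case_prod U (prod_decode n)"
  have "hausdorff_pre s \<delta> (\<Union>i. A i) \<le> (\<Sum>n. ennreal (diam_pow s (?V n)))"
  proof (rule hausdorff_pre_le)
    show "(\<Union>i. A i) \<subseteq> (\<Union>n. ?V n)"
    proof
      fix x assume "x \<in> (\<Union>i. A i)"
      then obtain i j where "x \<in> U i j" using U(1) by blast
      then have "x \<in> ?V (prod_encode (i, j))" by simp
      then show "x \<in> (\<Union>n. ?V n)" by (rule UN_I[OF UNIV_I])
    qed
  qed (simp_all add: case_prod_beta U(2,3))
  also have "\<dots> = (\<Sum>i. \<Sum>j. ennreal (diam_pow s (U i j)))"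
    using suminf_ennreal_2dimen[of "\<lambda>i. \<Sum>j. ennreal (diam_pow s (U i j))" "\<lambda>(i, j). ennreal (diam_pow s (U i j))"]
    by (simp add: case_prod_beta)
  also have "\<dots> \<le> (\<Sum>i. hausdorff_pre s \<delta> (A i) + ennreal e * ennreal ((1 / 2) ^ Suc i))"
    by (intro suminf_le U) auto
  also have "\<dots> = (\<Sum>i. hausdorff_pre s \<delta> (A i)) + (\<Sum>i. ennreal e * ennreal ((1 / 2) ^ Suc i))"
    by (intro suminf_add[symmetric]) auto
  also have "(\<Sum>i. ennreal e * ennreal ((1 / 2) ^ Suc i)) = ennreal e"
    unfolding ennreal_suminf_cmult
    by (subst suminf_ennreal_eq[OF zero_le_power power_half_series]) auto
  finally show "hausdorff_pre s \<delta> (\<Union>i. A i) \<le> (\<Sum>i. hausdorff_pre s \<delta> (A i)) + ennreal e" .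
qed

text \<open>The convergence half of the Borel-Cantelli argument: a denominator \<open>q\<close> has
  at most \<open>3 * m * q\<close> admissible numerators, so its balls cost a multiple of
  \<open>q powr (1 - \<tau> * s)\<close>, which is summable as \<open>\<tau> * s > 2\<close>. One
  integer \<open>m\<close> bounds numerators and radii alike, so that countably many such sets will
  do.\<close>

lemma limsup_balls_pre_zero:
  fixes \<tau> s \<delta> :: real and m :: nat
  assumes \<tau>: "\<tau> \<ge> 1" and s: "0 < s" "\<tau> * s > 2" and \<delta>: "\<delta> > 0" and m: "m \<ge> 1"
  shows "hausdorff_pre s \<delta> {x. \<forall>n::nat. \<exists>p q::int. int n < q \<and> \<bar>p\<bar> \<le> int m * q \<and>
     \<bar>x - of_int p / of_int q\<bar> \<le> real m * of_int q powr - \<tau>} = 0" (is "hausdorff_pre s \<delta> ?A = 0")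
proof -
  define f where "f q = 3 * real m * (2 * real m) powr s * real q powr (1 - \<tau> * s)" for q :: nat
  have summable: "summable f"
    unfolding f_def using s by (intro summable_mult) (simp add: summable_real_powr_iff)
  have f0: "f q \<ge> 0" for q by (simp add: f_def)
  \<comment> \<open>The index \<open>j\<close> is the numerator shifted by \<open>m * q\<close> to
    make it a natural number; empty sets beyond \<open>2 * m * q\<close> turn the balls into an
    infinite sequence.\<close>
  define B where "B q j = (if j \<le> 2 * m * q then cball (of_int (int j - int (m * q)) / real q) (real m * real q powr - \<tau>) else {})"
    for q j :: nat
  have B: "hausdorff_pre s \<delta> (\<Union>j. B q j) \<le> ennreal (f q)" if q: "q \<ge> 1" "2 * real m / \<delta> \<le> real q" for q
  proof -
    let ?r = "real m * real q powr - \<tau>"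
    have "real q powr - \<tau> \<le> real q powr - 1" using q(1) \<tau> by (intro powr_mono) auto
    then have "2 * real m * real q powr - \<tau> \<le> 2 * real m * real q powr - 1"
      by (intro mult_left_mono) auto
    then have "2 * ?r \<le> 2 * real m * (1 / real q)"
      using q(1) by (simp add: powr_minus inverse_eq_divide)
    also have "\<dots> \<le> \<delta>" using q \<delta> by (simp add: field_simps)
    finally have r: "2 * ?r \<le> \<delta>" .
    have "hausdorff_pre s \<delta> (\<Union>j. B q j) \<le> (\<Sum>j. hausdorff_pre s \<delta> (B q j))"
      by (rule hausdorff_pre_countably_subadditive)
    also have "\<dots> = (\<Sum>j\<in>{..2 * m * q}. hausdorff_pre s \<delta> (B q j))"
      using \<delta> by (intro suminf_finite) (auto simp: B_def)
    also have "\<dots> \<le> (\<Sum>j\<in>{..2 * m * q}. ennreal ((2 * ?r) powr s))"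
      using s r by (intro sum_mono) (auto simp: B_def intro!: hausdorff_pre_cball)
    also have "\<dots> = ennreal (real (2 * m * q + 1) * (2 * ?r) powr s)"
      by (subst sum_ennreal) auto
    also have "\<dots> \<le> ennreal (f q)"
    proof (rule ennreal_leI)
      have "1 * 1 \<le> m * q" using m q(1) by (intro mult_mono) auto
      then have "2 * m * q + 1 \<le> 3 * m * q" by simp
      then have "real (2 * m * q + 1) \<le> real (3 * m * q)" by (simp only: of_nat_le_iff)
      then have "real (2 * m * q + 1) \<le> 3 * real m * real q" by simp
      then have "real (2 * m * q + 1) * (2 * ?r) powr s \<le> 3 * real m * real q * (2 * ?r) powr s"
        by (intro mult_right_mono) auto
      also have "3 * real m * real q * (2 * ?r) powr s = 3 * real m * real q * ((2 * real m) powr s * real q powr (- \<tau> * s))"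
        by (simp add: powr_mult powr_powr)
      also have "3 * real m * real q * ((2 * real m) powr s * real q powr (- \<tau> * s)) =
          3 * real m * (2 * real m) powr s * (real q powr 1 * real q powr (- \<tau> * s))"
        using q(1) by simp
      also have "real q powr 1 * real q powr (- \<tau> * s) = real q powr (1 - \<tau> * s)"
        by (subst powr_add[symmetric]) simp
      finally show "real (2 * m * q + 1) * (2 * ?r) powr s \<le> f q" by (simp add: f_def)
    qed
    finally show ?thesis .
  qed
  have "hausdorff_pre s \<delta> ?A \<le> 0 + ennreal e" if e: "e > 0" for e
  proof -
    obtain N where N: "\<And>n. n \<ge> N \<Longrightarrow> norm (\<Sum>i. f (i + n)) < e"
      using suminf_exist_split[OF e summable] by blast
    \<comment> \<open>Denominators from \<open>n\<close> on are non-zero and large enough for the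
      balls to have diameter at most \<delta>.\<close>
    define n where "n = max N (nat \<lceil>2 * real m / \<delta>\<rceil>) + 1"
    have n: "n \<ge> N" "n \<ge> 1" "2 * real m / \<delta> \<le> real n" unfolding n_def by linarith+
    have "?A \<subseteq> (\<Union>i. \<Union>j. B (i + n) j)"
    proof
      fix x assume "x \<in> ?A"
      then obtain p q where pq: "int n < q" "\<bar>p\<bar> \<le> int m * q" "\<bar>x - of_int p / of_int q\<bar> \<le> real m * of_int q powr - \<tau>"
        by blast
      define k where "k = nat q"
      have q: "q = int k" using pq(1) by (simp add: k_def)
      let ?j = "nat (p + int (m * k))"
      have "- int (m * k) \<le> p" "p \<le> int (m * k)" using pq(2) q by auto
      then have "?j \<le> 2 * (m * k)" "int ?j = p + int (m * k)" by linarith+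
      then have j: "?j \<le> 2 * m * k" "int ?j = p + int (m * k)" by (simp_all add: mult.assoc)
      have "x \<in> B (k - n + n) ?j"
        using pq(1,3) j q by (auto simp: B_def dist_real_def abs_minus_commute)
      then show "x \<in> (\<Union>i. \<Union>j. B (i + n) j)" by (intro UN_I[OF UNIV_I])
    qed
    then have "hausdorff_pre s \<delta> ?A \<le> hausdorff_pre s \<delta> (\<Union>i. \<Union>j. B (i + n) j)"
      by (rule hausdorff_pre_mono)
    also have "\<dots> \<le> (\<Sum>i. hausdorff_pre s \<delta> (\<Union>j. B (i + n) j))"
      by (rule hausdorff_pre_countably_subadditive)
    also have "\<dots> \<le> (\<Sum>i. ennreal (f (i + n)))"
      using n by (intro suminf_le B) auto
    also have "\<dots> = ennreal (\<Sum>i. f (i + n))"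
      using f0 summable by (intro suminf_ennreal2) (auto simp: summable_iff_shift)
    also have "\<dots> \<le> ennreal e"
      using N[OF n(1)] by (intro ennreal_leI) auto
    finally show ?thesis by simp
  qed
  note le = this
  have "hausdorff_pre s \<delta> ?A \<le> 0" by (rule ennreal_le_epsilon) (rule le)
  then show ?thesis by simp
qed

lemma infinite_unbounded_denominators:
  fixes S :: "(int \<times> int) set"
  assumes "infinite S" "\<And>p q. (p, q) \<in> S \<Longrightarrow> 0 < q \<and> \<bar>p\<bar> \<le> m * q"
  shows "\<exists>p q. (p, q) \<in> S \<and> n < q"
proof (rule ccontr)
  assume "\<not> ?thesis"
  then have le: "q \<le> n" if "(p, q) \<in> S" for p q using that by force
  have "S \<subseteq> {- \<bar>m\<bar> * \<bar>n\<bar>..\<bar>m\<bar> * \<bar>n\<bar>} \<times> {0..n}"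
  proof
    fix z assume z: "z \<in> S"
    obtain p q where pq: "z = (p, q)" by fastforce
    have q: "0 < q" "\<bar>p\<bar> \<le> m * q" "q \<le> n" using z le assms(2) pq by auto
    have "m * q \<le> \<bar>m\<bar> * \<bar>n\<bar>" using q by (intro mult_mono) auto
    then show "z \<in> {- \<bar>m\<bar> * \<bar>n\<bar>..\<bar>m\<bar> * \<bar>n\<bar>} \<times> {0..n}" using q pq by auto
  qed
  then show False using assms(1) finite_subset by blast
qed

text \<open>The constant \<open>C\<close> ranges over uncountably many values; rounding
  \<open>\<bar>x\<bar> + C\<close> up to an integer leaves a countable union. The same integer
  bounds \<open>\<bar>p / q\<bar>\<close>, because \<open>q powr (- \<tau>) \<le> 1\<close>.\<close>

lemma hausdorff_measure_approx_set_eq_0: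
  assumes \<tau>: "\<tau> \<ge> 2" and s: "s > 2 / \<tau>"
  shows "hausdorff_measure s (approx_set \<Gamma> \<aa> \<tau>) = 0"
proof -
  have ts: "\<tau> * s > 2" using \<tau> s by (simp add: field_simps)
  have s0: "s > 0" using \<tau> s by (smt (verit) divide_pos_pos)
  let ?A = "\<lambda>m. {x. \<forall>n::nat. \<exists>p q::int. int n < q \<and> \<bar>p\<bar> \<le> int m * q \<and>
     \<bar>x - of_int p / of_int q\<bar> \<le> real m * of_int q powr - \<tau>}"
  have sub: "approx_set \<Gamma> \<aa> \<tau> \<subseteq> (\<Union>m. ?A (Suc m))"
  proof
    fix x assume "x \<in> approx_set \<Gamma> \<aa> \<tau>"
    then obtain C where C: "C > 0" "infinite {pq :: int \<times> int. let p = fst pq; q = snd pq in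
      q > 0 \<and> coprime p q \<and> Fin (Fract p q) \<in> cusp_orbit \<Gamma> \<aa> \<and>
      \<bar>x - real_of_int p / real_of_int q\<bar> \<le> C * real_of_int q powr (- \<tau>)}" (is "infinite ?S")
      by (auto simp: approx_set_def)
    define m where "m = nat \<lceil>\<bar>x\<bar> + C\<rceil>"
    have m: "\<bar>x\<bar> + C \<le> real (Suc m)" unfolding m_def by linarith
    have S: "0 < q \<and> \<bar>p\<bar> \<le> int (Suc m) * q \<and> \<bar>x - of_int p / of_int q\<bar> \<le> real (Suc m) * of_int q powr - \<tau>"
      if "(p, q) \<in> ?S" for p q
    proof -
      have q: "0 < q" "\<bar>x - of_int p / of_int q\<bar> \<le> C * of_int q powr - \<tau>" using that by (auto simp: Let_def)
      have "C * of_int q powr - \<tau> \<le> C * of_int q powr 0"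
        using q(1) \<tau> C(1) by (intro mult_left_mono powr_mono) auto
      then have "\<bar>x - of_int p / of_int q\<bar> \<le> C" using q by simp
      then have "\<bar>of_int p / of_int q\<bar> \<le> real (Suc m)" using m by linarith
      then have "\<bar>real_of_int p\<bar> \<le> real (Suc m) * of_int q" using q(1) by (simp add: abs_divide pos_divide_le_eq)
      then have "real_of_int \<bar>p\<bar> \<le> of_int (int (Suc m) * q)" by simp
      then have "\<bar>p\<bar> \<le> int (Suc m) * q" by (simp only: of_int_le_iff)
      moreover have "C * of_int q powr - \<tau> \<le> real (Suc m) * of_int q powr - \<tau>"
        using m by (intro mult_right_mono) auto
      ultimately show ?thesis using q(1) order_trans[OF q(2)] by blast
    qed
    have "\<exists>p q. (p, q) \<in> ?S \<and> int n < q" for n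
      using infinite_unbounded_denominators[OF C(2), of "int (Suc m)"] S by blast
    then have "x \<in> ?A (Suc m)" using S by blast
    then show "x \<in> (\<Union>m. ?A (Suc m))" by blast
  qed
  have "hausdorff_pre s \<delta> (approx_set \<Gamma> \<aa> \<tau>) = 0" if "\<delta> > 0" for \<delta>
  proof -
    have "hausdorff_pre s \<delta> (approx_set \<Gamma> \<aa> \<tau>) \<le> hausdorff_pre s \<delta> (\<Union>m. ?A (Suc m))"
      by (rule hausdorff_pre_mono[OF sub])
    also have "\<dots> \<le> (\<Sum>m. hausdorff_pre s \<delta> (?A (Suc m)))"
      by (rule hausdorff_pre_countably_subadditive)
    also have "(\<lambda>m. hausdorff_pre s \<delta> (?A (Suc m))) = (\<lambda>m. 0)"
      by (intro ext limsup_balls_pre_zero) (use \<tau> s0 ts that in auto)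
    finally show ?thesis by simp
  qed
  then show ?thesis by (simp add: hausdorff_measure_def)
qed

section \<open>Dependence on the exponent, and the dimension\<close>

text \<open>Powers of diameters at most 1 decrease with the exponent, and lowering \<delta> to at
  most 1 only increases the premeasure. Infinite measure thus passes to all smaller
  exponents.\<close>

lemma hausdorff_measure_antimono_exponent:
  assumes s: "0 \<le> s" "s \<le> t" and t: "0 < t"
  shows "hausdorff_measure t A \<le> hausdorff_measure s A"
  unfolding hausdorff_measure_def
proof (rule SUP_least)
  fix \<delta> :: real assume \<delta>: "\<delta> \<in> {0<..}"
  have le: "diam_pow t U \<le> diam_pow s U" if U: "bounded U" "diameter U \<le> 1" for U
  proof (cases "U = {}")
    case False
    have d: "0 \<le> diameter U" using U(1) by (rule diameter_ge_0)
    have "diameter U powr t \<le> (if s = 0 then 1 else diameter U powr s)"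
    \<comment> \<open>For diameter 0 and \<open>s > 0\<close> both sides vanish; for
      \<open>s = 0\<close> the convention makes the right side 1, which bounds every positive power
      of a diameter at most 1.\<close>
    proof (cases "diameter U = 0 \<or> s = 0")
      case True
      then show ?thesis using U d t powr_mono2[of t "diameter U" 1] by (cases "s = 0") auto
    next
      case False
      then show ?thesis using U d s by (auto intro!: powr_mono')
    qed
    then show ?thesis using False t by (simp add: diam_pow_def)
  qed (simp add: diam_pow_def)
  have "hausdorff_pre t \<delta> A \<le> hausdorff_pre t (min \<delta> 1) A"
    unfolding hausdorff_pre_def by (intro INF_superset_mono) auto
  also have "\<dots> \<le> hausdorff_pre s (min \<delta> 1) A"
  proof (rule hausdorff_pre_geI)
    fix U :: "nat \<Rightarrow> real set"
    assume U: "A \<subseteq> (\<Union>i. U i)" "\<And>i. bounded (U i)" "\<And>i. diameter (U i) \<le> min \<delta> 1"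
    have "hausdorff_pre t (min \<delta> 1) A \<le> (\<Sum>i. ennreal (diam_pow t (U i)))"
      by (intro hausdorff_pre_le U)
    also have "\<dots> \<le> (\<Sum>i. ennreal (diam_pow s (U i)))"
      using U by (intro suminf_le ennreal_leI le) auto
    finally show "hausdorff_pre t (min \<delta> 1) A \<le> (\<Sum>i. ennreal (diam_pow s (U i)))" .
  qed
  also have "\<dots> \<le> (SUP \<delta>\<in>{0<..}. hausdorff_pre s \<delta> A)"
    using \<delta> by (intro SUP_upper) auto
  finally show "hausdorff_pre t \<delta> A \<le> (SUP \<delta>\<in>{0<..}. hausdorff_pre s \<delta> A)" .
qed

lemma hausdorff_dim_eqI:
  assumes "0 < t" "hausdorff_measure t A = \<infinity>" "\<And>s. t < s \<Longrightarrow> hausdorff_measure s A = 0"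
  shows "hausdorff_dim A = t"
proof -
  have "{s. s \<ge> 0 \<and> hausdorff_measure s A = 0} = {t<..}"
  proof (intro equalityI subsetI)
    fix s assume "s \<in> {s. s \<ge> 0 \<and> hausdorff_measure s A = 0}"
    then show "s \<in> {t<..}"
      using hausdorff_measure_antimono_exponent[of s t A] assms(1,2) by (auto simp: not_less[symmetric] intro!: leI)
  qed (use assms in auto)
  then show ?thesis by (simp add: hausdorff_dim_def)
qed

section \<open>The approximation set\<close>

text \<open>With \<open>\<alpha> = 2 powr (- s)\<close> the condition
  \<open>N^2 * \<alpha> ^ k \<le> 1\<close> says that the cell length \<open>2 powr (- k)\<close> is
  at most \<open>N powr (- 2 / s)\<close>, and \<open>q \<le> K * N\<close> turns this into a bound
  by a power of \<open>q\<close>. The 2 in the constant is the reach of \<open>near_cell\<close>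
  measured in cell lengths.\<close>

lemma limsup_cells_subset_approx_set:
  fixes s K :: real
  assumes s: "0 < s" and K: "K > 0"
  shows "limsup_cells (2 powr - s) (\<lambda>N. orbit_points \<Gamma> \<aa> (K * real N)) \<subseteq> approx_set \<Gamma> \<aa> (2 / s)"
proof
  let ?X = "\<lambda>N. orbit_points \<Gamma> \<aa> (K * real N)"
  fix x assume x: "x \<in> limsup_cells (2 powr - s) ?X"
  define S where "S = {pq :: int \<times> int. let p = fst pq; q = snd pq in
      q > 0 \<and> coprime p q \<and> Fin (Fract p q) \<in> cusp_orbit \<Gamma> \<aa> \<and>
      \<bar>x - real_of_int p / real_of_int q\<bar> \<le> (2 * K powr (2 / s)) * real_of_int q powr (- (2 / s))}"
  have ex: "\<exists>p q. (p, q) \<in> S \<and> 0 < x - of_int p / of_int q \<and> x - of_int p / of_int q \<le> 2 * (1 / 2) ^ n" for n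
  proof -
    obtain J where J: "n \<le> fst J" "near_cell (2 powr - s) ?X J" "x \<in> ccell J"
      using x unfolding limsup_cells_def by blast
    define k where "k = fst J"
    obtain N r where r: "r \<in> ?X N" "(real N)\<^sup>2 * (2 powr - s) ^ k \<le> 1" "r < of_int (snd J) / 2 ^ k"
      "(of_int (snd J) + 1) / 2 ^ k \<le> r + 2 / 2 ^ k"
      using J(2) unfolding near_cell_def k_def by blast
    obtain p q where pq: "r = of_int p / of_int q" "0 < q" "of_int q \<le> K * real N" "coprime p q"
      "Fin (Fract p q) \<in> cusp_orbit \<Gamma> \<aa>"
      using r(1) by (auto simp: orbit_points_def)
    have xr: "0 < x - r" "x - r \<le> 2 * (1 / 2) ^ k"
      using J(3) r(3,4) by (auto simp: ccell_def k_def power_one_over)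
    have N: "0 < real N" using pq(2,3) K by (cases "N = 0") auto
    have "((1 / 2) ^ k) powr s \<le> 1 / (real N)\<^sup>2"
      using r(2) N unfolding powr_minus_power by (simp add: field_simps)
    then have "(((1 / 2) ^ k) powr s) powr (1 / s) \<le> (1 / (real N)\<^sup>2) powr (1 / s)"
      using s by (intro powr_mono2) auto
    then have "(1 / 2) ^ k \<le> (1 / (real N)\<^sup>2) powr (1 / s)"
      using s by (simp add: powr_powr)
    also have "\<dots> = (1 / real N) powr (2 / s)"
    proof -
      have "1 / (real N)\<^sup>2 = (1 / real N) powr 2" using N by (simp add: power_one_over)
      then show ?thesis by (simp only: powr_powr times_divide_eq_right mult_1_right)
    qed
    also have "\<dots> \<le> (K / of_int q) powr (2 / s)"
      using pq(2,3) N s by (intro powr_mono2) (auto simp: field_simps)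
    also have "\<dots> = K powr (2 / s) * of_int q powr (- (2 / s))"
      using K pq(2) by (simp add: powr_divide powr_minus_divide)
    finally have "\<bar>x - r\<bar> \<le> (2 * K powr (2 / s)) * of_int q powr (- (2 / s))"
      using xr by simp
    then have "(p, q) \<in> S" using pq by (simp add: S_def)
    moreover have "(1 / 2 :: real) ^ k \<le> (1 / 2) ^ n" using J(1) by (simp add: k_def power_decreasing)
    ultimately have "(p, q) \<in> S \<and> 0 < x - r \<and> x - r \<le> 2 * (1 / 2) ^ n" using xr by linarith
    then show ?thesis unfolding pq(1) by blast
  qed
  have "infinite S"
  proof
    assume fin: "finite S"
    \<comment> \<open>By \<open>ex\<close> there are arbitrarily small positive differences, which a
      finite set excludes. Non-positive ones are discarded, as \<open>x\<close> may itself be an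
      orbit point.\<close>
    define D where "D = {d. d > 0 \<and> d \<in> (\<lambda>(p, q). x - of_int p / of_int q) ` S}"
    have finD: "finite D" using fin by (simp add: D_def)
    have memD: "x - of_int p / of_int q \<in> D" if "(p, q) \<in> S" "0 < x - of_int p / of_int q" for p q
      unfolding D_def using that by (intro CollectI conjI image_eqI[of _ _ "(p, q)"]) simp_all
    then have ne: "D \<noteq> {}" using ex[of 0] by blast
    have "Min D > 0" using Min_in[OF finD ne] by (simp add: D_def)
    then obtain n where n: "(1 / 2 :: real) ^ n < Min D / 2" using real_arch_pow_inv[of "Min D / 2" "1 / 2"] by auto
    obtain p q where pq: "(p, q) \<in> S" "0 < x - of_int p / of_int q" "x - of_int p / of_int q \<le> 2 * (1 / 2) ^ n"
      using ex[of n] by blast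
    have "x - of_int p / of_int q \<in> D" using memD pq(1,2) by blast
    then have "Min D \<le> x - of_int p / of_int q" using finD by (rule Min_le[rotated])
    then show False using pq(3) n by simp
  qed
  moreover have "2 * K powr (2 / s) > 0" using K by simp
  ultimately show "x \<in> approx_set \<Gamma> \<aa> (2 / s)" unfolding approx_set_def S_def by blast
qed

text \<open>Dirichlet's theorem gives infinitely many \<open>h / k\<close> with error below
  \<open>1 / k^2\<close>. A weighted mediant \<open>P / Q\<close> with a neighbour lies in the
  orbit, its denominator is between \<open>k\<close> and \<open>2 * K * k\<close>, and
  \<open>Q * x - P\<close> is at most \<open>3 * K / k \<le> 6 * K^2 / Q\<close> in absolute value;
  this is the origin of the constant.\<close>

lemma irrational_in_approx_set:
  fixes x :: real
  assumes K: "K \<ge> 1" and vec: "\<And>a b c d. a * d - b * c = 1 \<Longrightarrow>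
       \<exists>u v. 1 \<le> u \<and> u \<le> K \<and> 1 \<le> v \<and> v \<le> K \<and> coprime u v
         \<and> cusp_of (a * u + b * v) (c * u + d * v) \<in> cusp_orbit \<Gamma> \<aa>"
    and x: "x \<notin> \<rat>"
  shows "x \<in> approx_set \<Gamma> \<aa> 2"
proof -
  let ?C = "6 * (real_of_int K)\<^sup>2"
  define S where "S = {pq :: int \<times> int. let p = fst pq; q = snd pq in
      q > 0 \<and> coprime p q \<and> Fin (Fract p q) \<in> cusp_orbit \<Gamma> \<aa> \<and>
      \<bar>x - real_of_int p / real_of_int q\<bar> \<le> ?C * real_of_int q powr - 2}"
  have ex: "\<exists>p q. (p, q) \<in> S \<and> n < q" for n
  proof -
    have "infinite (Kronecker_Approximation_Theorem.approx_set x)"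
      using x rational_iff_finite_approx_set by blast
    from infinite_approx_set[OF this, of n] obtain h k where
      "(h, k) \<in> Kronecker_Approximation_Theorem.approx_set x" "k > n" by blast
    then have hk: "k > 0" "k > n" "coprime h k" "\<bar>x - of_int h / of_int k\<bar> < 1 / (of_int k)\<^sup>2"
      by (auto simp: Kronecker_Approximation_Theorem.approx_set_def)
    \<comment> \<open>The window of \<open>farey_neighbour\<close> is taken at \<open>N = k\<close>,
      so that \<open>0 < q' \<le> k\<close>.\<close>
    obtain p' q' where nb: "p' * k - h * q' = 1" "k - k < q'" "q' \<le> k"
      using farey_neighbour[OF hk(3,1)] by blast
    have q': "0 < q'" using nb(2) by simp
    obtain u v where uv: "1 \<le> u" "u \<le> K" "1 \<le> v" "v \<le> K" "coprime u v"
      "cusp_of (p' * u + h * v) (q' * u + k * v) \<in> cusp_orbit \<Gamma> \<aa>"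
      using vec[of p' k h q'] nb(1) by blast
    let ?P = "p' * u + h * v" and ?Q = "q' * u + k * v"
    have Qk: "k < ?Q"
    proof -
      have "0 < q' * u" using q' uv(1) by simp
      moreover have "k * 1 \<le> k * v" using hk(1) uv(3) by (intro mult_left_mono) auto
      ultimately show ?thesis by simp
    qed
    then have Q: "0 < ?Q" using hk(1) by simp
    have "q' * u \<le> k * K" "k * v \<le> k * K"
      using uv nb(3) hk(1) q' by (auto intro!: mult_mono)
    then have "?Q \<le> 2 * K * k" by (simp add: algebra_simps)
    then have QK: "real_of_int ?Q \<le> 2 * of_int K * of_int k"
      by (metis of_int_le_iff of_int_mult of_int_numeral)
    define kr where "kr = real_of_int k"
    have kr: "kr > 0" using hk(1) by (simp add: kr_def)
    have e1: "\<bar>kr * x - of_int h\<bar> \<le> 1 / kr"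
    proof -
      have "\<bar>kr * x - of_int h\<bar> = kr * \<bar>x - of_int h / kr\<bar>"
        using kr by (simp add: abs_mult_pos' algebra_simps)
      also have "\<dots> \<le> kr * (1 / kr\<^sup>2)" using hk(4) kr by (intro mult_left_mono) (auto simp: kr_def)
      also have "\<dots> = 1 / kr" using kr by (simp add: power2_eq_square)
      finally show ?thesis .
    qed
    have e2: "\<bar>of_int q' * x - of_int p'\<bar> \<le> 2 / kr"
    proof -
      have det: "of_int p' * kr - of_int h * of_int q' = (1::real)"
        using nb(1) unfolding kr_def by (metis of_int_1 of_int_diff of_int_mult)
      \<comment> \<open>The determinant gives \<open>q' * h - k * p' = - 1\<close>, so the linear
        form of the neighbour is \<open>q' / k\<close> times that of \<open>h / k\<close>, up to an
        error \<open>1 / k\<close>.\<close>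
      have "kr * \<bar>of_int q' * x - of_int p'\<bar> = \<bar>of_int q' * (kr * x - of_int h) - 1\<bar>"
        using kr det by (simp add: abs_mult_pos' algebra_simps)
      also have "\<dots> \<le> of_int q' * \<bar>kr * x - of_int h\<bar> + 1"
        using q' abs_triangle_ineq4[of "of_int q' * (kr * x - of_int h)" 1] by (simp add: abs_mult)
      also have "\<dots> \<le> kr * (1 / kr) + 1"
        using nb(3) q' e1 by (intro add_mono mult_mono) (auto simp: kr_def)
      also have "\<dots> = 2" using kr by simp
      finally show ?thesis using kr by (simp add: field_simps)
    qed
    have "of_int ?Q * x - of_int ?P = of_int u * (of_int q' * x - of_int p') + of_int v * (kr * x - of_int h)"
      by (simp add: kr_def algebra_simps)
    also have "\<bar>\<dots>\<bar> \<le> of_int u * \<bar>of_int q' * x - of_int p'\<bar> + of_int v * \<bar>kr * x - of_int h\<bar>"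
      using uv abs_triangle_ineq[of "of_int u * (of_int q' * x - of_int p')" "of_int v * (kr * x - of_int h)"]
      by (simp add: abs_mult)
    also have "\<dots> \<le> of_int K * (2 / kr) + of_int K * (1 / kr)"
      using uv e1 e2 K by (intro add_mono mult_mono) auto
    also have "\<dots> = 3 * of_int K / kr" by simp
    finally have e3: "\<bar>of_int ?Q * x - of_int ?P\<bar> \<le> 3 * of_int K / kr" .
    define Qr where "Qr = real_of_int ?Q"
    have Qr: "Qr > 0" using Q unfolding Qr_def by (simp only: of_int_0_less_iff)
    have "x - of_int ?P / Qr = (Qr * x - of_int ?P) / Qr" using Qr by (simp add: diff_divide_distrib)
    then have "\<bar>x - of_int ?P / Qr\<bar> = \<bar>Qr * x - of_int ?P\<bar> / Qr" using Qr by (simp add: abs_divide)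
    also have "\<dots> \<le> (3 * of_int K / kr) / Qr"
      using e3 Qr unfolding Qr_def by (intro divide_right_mono) auto
    also have "\<dots> \<le> (3 * of_int K * (2 * of_int K / Qr)) / Qr"
    proof (intro divide_right_mono)
      have "1 / kr \<le> 2 * of_int K / Qr" using QK kr Qr unfolding Qr_def[symmetric] kr_def[symmetric]
        by (simp add: field_simps)
      then have "3 * of_int K * (1 / kr) \<le> 3 * of_int K * (2 * of_int K / Qr)"
        using K by (intro mult_left_mono) auto
      then show "3 * of_int K / kr \<le> 3 * of_int K * (2 * of_int K / Qr)" by simp
    qed (use Qr in simp)
    also have "\<dots> = ?C * Qr powr - 2"
      using Qr by (simp add: powr_minus power2_eq_square field_simps)
    finally have "\<bar>x - of_int ?P / of_int ?Q\<bar> \<le> ?C * of_int ?Q powr - 2" unfolding Qr_def .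
    moreover have "Fin (Fract ?P ?Q) \<in> cusp_orbit \<Gamma> \<aa>"
      using uv(6) Q by (simp add: cusp_of_def split: if_splits)
    moreover have "coprime ?P ?Q"
      using coprime_det_one_image[OF _ uv(5), of p' k h q'] nb(1) by simp
    ultimately have "(?P, ?Q) \<in> S" using Q by (simp only: S_def Let_def mem_Collect_eq fst_conv snd_conv simp_thms)
    moreover have "n < ?Q" using Qk hk(2) by simp
    ultimately show ?thesis by blast
  qed
  have "infinite S"
  proof
    assume fin: "finite S"
    obtain p q where pq: "(p, q) \<in> S" "Max (snd ` S) < q" using ex by blast
    have "q \<le> Max (snd ` S)" using fin pq(1) by (intro Max_ge) force+
    then show False using pq(2) by simp
  qed
  moreover have "?C > 0" using K by simp
  ultimately show ?thesis unfolding approx_set_def S_def by blast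
qed

lemma hausdorff_measure_approx_set_eq_top:
  assumes \<Gamma>: "subgroup \<Gamma> SL2Z_group" "finite (rcosets\<^bsub>SL2Z_group\<^esub> \<Gamma>)" and \<tau>: "\<tau> \<ge> 2"
  shows "hausdorff_measure (2 / \<tau>) (approx_set \<Gamma> \<aa> \<tau>) = \<infinity>"
proof -
  obtain K :: int where K: "K \<ge> 1" and vec: "\<And>a b c d. a * d - b * c = 1 \<Longrightarrow>
       \<exists>u v. 1 \<le> u \<and> u \<le> K \<and> 1 \<le> v \<and> v \<le> K \<and> coprime u v
         \<and> cusp_of (a * u + b * v) (c * u + d * v) \<in> cusp_orbit \<Gamma> \<aa>"
    using orbit_vectors[OF \<Gamma>] by metis
  show ?thesis
  proof (cases "\<tau> = 2")
    case True
    have "- approx_set \<Gamma> \<aa> 2 \<subseteq> \<rat>" using irrational_in_approx_set[OF K vec] by blast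
    then have "countable (- approx_set \<Gamma> \<aa> 2)" using countable_rat countable_subset by blast
    then show ?thesis using hausdorff_measure_one_cocountable True by simp
  next
    case False
    define s where "s = 2 / \<tau>"
    have s: "0 < s" "s < 1" "2 / s = \<tau>" using \<tau> False by (auto simp: s_def)
    define \<alpha> where "\<alpha> = 2 powr - s"
    \<comment> \<open>The denominator bound of \<open>orbit_points_dense\<close>, which at the same
      time is the separation constant.\<close>
    define R where "R = 2 * real_of_int K"
    let ?X = "\<lambda>N. orbit_points \<Gamma> \<aa> (R * real N)"
    have "2 powr -1 < 2 powr - s" "2 powr - s < 2 powr 0" using s by (intro powr_less_mono; simp)+
    then have \<alpha>: "1 / 2 < \<alpha>" "\<alpha> < 1" by (simp_all add: \<alpha>_def powr_minus)
    have "\<exists>c0>0. fills \<alpha> ?X c0"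
    proof (rule ubiquity_fills[OF \<alpha>, of R "1 / 32"])
      show "1 / (R * real N)\<^sup>2 \<le> \<bar>x - y\<bar>" if "x \<in> ?X N" "y \<in> ?X N" "x \<noteq> y" for N x y
        by (rule orbit_points_separated[OF that])
      show "\<exists>N0. \<forall>N\<ge>N0. \<exists>P \<subseteq> ?X N \<inter> {a..<a + l}. finite P \<and> 1 / 32 * l * (real N)\<^sup>2 \<le> card P"
        if "l > 0" for a l
        using orbit_points_dense[OF K vec that, of a] by (simp add: R_def)
    qed (use K in \<open>auto simp: R_def\<close>)
    then have "fills \<alpha> ?X 1" using fills_one[OF \<alpha>] by blast
    then have "hausdorff_measure s (limsup_cells \<alpha> ?X) = \<infinity>"
      unfolding \<alpha>_def by (rule hausdorff_measure_limsup_cells[OF s(1,2)])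
    moreover have "limsup_cells \<alpha> ?X \<subseteq> approx_set \<Gamma> \<aa> \<tau>"
      using limsup_cells_subset_approx_set[OF s(1), of R \<Gamma> \<aa>] K by (simp add: \<alpha>_def s(3) R_def)
    ultimately have "\<infinity> \<le> hausdorff_measure s (approx_set \<Gamma> \<aa> \<tau>)"
      by (metis hausdorff_measure_mono)
    then show ?thesis by (simp add: s_def top_unique)
  qed
qed

theorem theorem9:
  fixes \<Gamma> :: "(int^2^2) set" and \<aa> :: cusp and \<tau> :: real
  assumes "subgroup \<Gamma> SL2Z_group"
    and "finite (rcosets\<^bsub>SL2Z_group\<^esub> \<Gamma>)"
    and "\<tau> \<ge> 2"
  shows "hausdorff_dim (approx_set \<Gamma> \<aa> \<tau>) = 2 / \<tau>
       \<and> hausdorff_measure (2 / \<tau>) (approx_set \<Gamma> \<aa> \<tau>) = \<infinity>"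
proof
  show top: "hausdorff_measure (2 / \<tau>) (approx_set \<Gamma> \<aa> \<tau>) = \<infinity>"
    by (rule hausdorff_measure_approx_set_eq_top[OF assms])
  show "hausdorff_dim (approx_set \<Gamma> \<aa> \<tau>) = 2 / \<tau>"
    using assms(3) by (intro hausdorff_dim_eqI top hausdorff_measure_approx_set_eq_0) auto
qed

end
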